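(* Let $E_s>0$ and let $\{H_k\}_{k\ge0}$ be i.i.d. nonnegative random variables whose distribution is absolutely continuous with respect to Lebesgue measure, with finite mean $\bar H=E[H_k]$. Let $\{B_k\}_{k\ge 0}$ be the Markov chain on $[0,\infty)$ defined by $$B_{k+1}=B_k+H_k-1_{(B_k>E_s)}\,E_s .$$ If $\bar H<E_s$, then $\{B_k\}$ is a positive Harris recurrent Markov chain and has a unique invariant (stationary) probability measure.
   Context: $B_k$ is the energy stored at time $k$ in an infinite-capacity battery of an energy harvesting sensor, $H_k$ the energy harvested in slot $k$ and $E_s$ the energy consumed when a sample is sensed and processed (which happens in slot $k$ exactly when $B_k>E_s$). The initial state $B_0\ge0$ is independent of $\{H_k\}$. Positive Harris recurrence is in the standard sense of general state space Markov chains (Meyn and Tweedie). *)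

theory Defs
  imports "HOL-Probability.Probability"
begin

section \<open>Markov chains on a general state space\<close>

text \<open>A chain on the measurable space \<open>S\<close> is given by its one-step kernel \<open>K\<close>, with \<open>K x A = P(x, A)\<close>.\<close>

definition transition_kernel :: "'a measure \<Rightarrow> ('a \<Rightarrow> 'a measure) \<Rightarrow> bool" where
  "transition_kernel S K \<longleftrightarrow> K \<in> S \<rightarrow>\<^sub>M prob_algebra S"

text \<open>\<open>fdd K n A x\<close> is the iterated integral
  \<open>1_{A 0}(x) \<integral>_{A 1} K(x, dy_1) \<dots> \<integral>_{A n} K(y_{n-1}, dy_n)\<close>.\<close>

primrec fdd :: "('a \<Rightarrow> 'a measure) \<Rightarrow> nat \<Rightarrow> (nat \<Rightarrow> 'a set) \<Rightarrow> 'a \<Rightarrow> ennreal" where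
  "fdd K 0 A x = indicator (A 0) x"
| "fdd K (Suc n) A x = indicator (A 0) x * (\<integral>\<^sup>+y. fdd K n (\<lambda>i. A (Suc i)) y \<partial>K x)"

definition markov_chain ::
    "'w measure \<Rightarrow> 'a measure \<Rightarrow> ('a \<Rightarrow> 'a measure) \<Rightarrow> (nat \<Rightarrow> 'w \<Rightarrow> 'a) \<Rightarrow> bool" where
  "markov_chain M S K X \<longleftrightarrow>
     prob_space M \<and> transition_kernel S K \<and> (\<forall>n. X n \<in> M \<rightarrow>\<^sub>M S) \<and>
     (\<forall>n A. (\<forall>i\<le>n. A i \<in> sets S) \<longrightarrow>
        emeasure M {\<omega> \<in> space M. \<forall>i\<le>n. X i \<omega> \<in> A i}
          = (\<integral>\<^sup>+x. fdd K n A x \<partial>distr M S (X 0)))"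

text \<open>\<open>path_law S K x\<close> is the law \<open>P_x\<close> on the path space \<open>S^\<nat>\<close> of the chain started at \<open>x\<close>,
  i.e. the projective limit that the theorem of Ionescu-Tulcea provides. In the library's
  formulation, coordinate \<open>n\<close> is drawn from a kernel that depends on the coordinates below \<open>n\<close>.\<close>

definition path_step :: "'a measure \<Rightarrow> ('a \<Rightarrow> 'a measure) \<Rightarrow> 'a \<Rightarrow> nat \<Rightarrow> (nat \<Rightarrow> 'a) \<Rightarrow> 'a measure" where
  "path_step S K x n h = (case n of 0 \<Rightarrow> return S x | Suc m \<Rightarrow> K (h m))"

definition path_law :: "'a measure \<Rightarrow> ('a \<Rightarrow> 'a measure) \<Rightarrow> 'a \<Rightarrow> (nat \<Rightarrow> 'a) measure" where
  "path_law S K x =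
     projective_family.lim UNIV (Ionescu_Tulcea.CI (path_step S K x) (\<lambda>_. S)) (\<lambda>_. S)"

lemma Ionescu_Tulcea_path_step:
  assumes "transition_kernel S K" "x \<in> space S"
  shows "Ionescu_Tulcea (path_step S K x) (\<lambda>_. S)"
proof (rule Ionescu_Tulcea.intro)
  have K[measurable]: "K \<in> S \<rightarrow>\<^sub>M subprob_algebra S"
    using assms(1) unfolding transition_kernel_def by (rule measurable_prob_algebraD)
  show "path_step S K x i \<in> PiM {0..<i} (\<lambda>_. S) \<rightarrow>\<^sub>M subprob_algebra S" for i
  proof (cases i)
    case 0
    have "(\<lambda>h. return S x) \<in> PiM {0..<i} (\<lambda>_. S) \<rightarrow>\<^sub>M subprob_algebra S"
      using assms(2)
      by (intro measurable_const) (simp add: space_subprob_algebra prob_space_imp_subprob_space prob_space_return)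
    with 0 show ?thesis by (simp add: path_step_def[abs_def])
  next
    case (Suc m)
    have "(\<lambda>h. K (h m)) \<in> PiM {0..<i} (\<lambda>_. S) \<rightarrow>\<^sub>M subprob_algebra S"
      by (rule measurable_compose[OF _ K]) (simp add: Suc)
    with Suc show ?thesis by (simp add: path_step_def[abs_def])
  qed
  fix i :: nat and h assume h: "h \<in> space (PiM {0..<i} (\<lambda>_. S))"
  show "prob_space (path_step S K x i h)"
  proof (cases i)
    case 0 then show ?thesis using assms(2) by (simp add: path_step_def prob_space_return)
  next
    case (Suc m)
    then have "h m \<in> space S" using h by (auto simp: space_PiM PiE_iff)
    then show ?thesis
      using assms(1) Suc measurable_space[of K S "prob_algebra S" "h m"]
      by (simp add: path_step_def transition_kernel_def space_prob_algebra)
  qed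
qed


section \<open>Positive Harris recurrence (Meyn and Tweedie)\<close>

definition invariant_probability :: "'a measure \<Rightarrow> ('a \<Rightarrow> 'a measure) \<Rightarrow> 'a measure \<Rightarrow> bool" where
  "invariant_probability S K \<pi> \<longleftrightarrow>
     prob_space \<pi> \<and> sets \<pi> = sets S \<and>
     (\<forall>A\<in>sets S. emeasure \<pi> A = (\<integral>\<^sup>+x. emeasure (K x) A \<partial>\<pi>))"

text \<open>\<open>L(x, A) = P_x(\<tau>_A < \<infinity>)\<close> and \<open>Q(x, A) = P_x(\<eta>_A = \<infinity>)\<close>; both the return time \<open>\<tau>_A\<close> and
  the occupation number \<open>\<eta>_A\<close> ignore time 0.\<close>

definition return_prob :: "'a measure \<Rightarrow> ('a \<Rightarrow> 'a measure) \<Rightarrow> 'a \<Rightarrow> 'a set \<Rightarrow> ennreal" where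
  "return_prob S K x A =
     emeasure (path_law S K x) {\<omega> \<in> space (path_law S K x). \<exists>n\<ge>1. \<omega> n \<in> A}"

definition infinitely_often_prob :: "'a measure \<Rightarrow> ('a \<Rightarrow> 'a measure) \<Rightarrow> 'a \<Rightarrow> 'a set \<Rightarrow> ennreal" where
  "infinitely_often_prob S K x A =
     emeasure (path_law S K x) {\<omega> \<in> space (path_law S K x). infinite {n. n \<ge> 1 \<and> \<omega> n \<in> A}}"

definition irreducibility_measure :: "'a measure \<Rightarrow> ('a \<Rightarrow> 'a measure) \<Rightarrow> 'a measure \<Rightarrow> bool" where
  "irreducibility_measure S K \<phi> \<longleftrightarrow>
     sigma_finite_measure \<phi> \<and> sets \<phi> = sets S \<and> emeasure \<phi> (space S) > 0 \<and>
     (\<forall>A\<in>sets S. emeasure \<phi> A > 0 \<longrightarrow> (\<forall>x\<in>space S. return_prob S K x A > 0))"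

definition maximal_irreducibility_measure :: "'a measure \<Rightarrow> ('a \<Rightarrow> 'a measure) \<Rightarrow> 'a measure \<Rightarrow> bool" where
  "maximal_irreducibility_measure S K \<psi> \<longleftrightarrow>
     irreducibility_measure S K \<psi> \<and>
     (\<forall>\<phi>. irreducibility_measure S K \<phi> \<longrightarrow> absolutely_continuous \<psi> \<phi>)"

definition harris_recurrent_set :: "'a measure \<Rightarrow> ('a \<Rightarrow> 'a measure) \<Rightarrow> 'a set \<Rightarrow> bool" where
  "harris_recurrent_set S K A \<longleftrightarrow> (\<forall>x\<in>A. infinitely_often_prob S K x A = 1)"

text \<open>The maximal irreducibility measures of a kernel are all equivalent, so the class
  \<open>{A. \<psi>(A) > 0}\<close> does not depend on the choice of \<open>\<psi>\<close>.\<close>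

definition harris_recurrent :: "'a measure \<Rightarrow> ('a \<Rightarrow> 'a measure) \<Rightarrow> bool" where
  "harris_recurrent S K \<longleftrightarrow>
     transition_kernel S K \<and>
     (\<exists>\<psi>. maximal_irreducibility_measure S K \<psi> \<and>
        (\<forall>A\<in>sets S. emeasure \<psi> A > 0 \<longrightarrow> harris_recurrent_set S K A))"

definition positive_harris_recurrent :: "'a measure \<Rightarrow> ('a \<Rightarrow> 'a measure) \<Rightarrow> bool" where
  "positive_harris_recurrent S K \<longleftrightarrow>
     harris_recurrent S K \<and> (\<exists>\<pi>. invariant_probability S K \<pi>)"


section \<open>The battery chain\<close>

definition battery_space :: "real measure" where
  "battery_space = restrict_space borel {0..}"

text \<open>The law of \<open>b + h - 1_(b > E_s) E_s\<close> when \<open>h\<close> is the random variable \<open>Y\<close> on \<open>M\<close>. It is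
  meaningful for \<open>b \<ge> 0\<close>, \<open>E_s \<ge> 0\<close> and \<open>Y \<ge> 0\<close>, which keep the next state in \<open>[0, \<infinity>)\<close>.\<close>

definition battery_kernel :: "'w measure \<Rightarrow> ('w \<Rightarrow> real) \<Rightarrow> real \<Rightarrow> real \<Rightarrow> real measure" where
  "battery_kernel M Y E_s b =
     distr M battery_space (\<lambda>\<omega>. b + Y \<omega> - indicator {E_s<..} b * E_s)"

end

theory Submission
  imports Defs
begin

text \<open>Modulo \<open>E_s\<close> the chain is the random walk with steps \<open>H_k\<close> on a circle. Bounded harmonic
  functions of this walk are constant, because the steps have a density. Two chains whose distance
  is a multiple of \<open>E_s\<close>, driven by the same harvests, merge almost surely: the drift
  is negative, so the lower one keeps returning to \<open>[0, E_s]\<close>, and there the distance drops. Together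
  these facts make bounded harmonic functions of the chain constant and its invariant probability
  measure unique.

  An invariant measure is explicit: it is the law of \<open>W + V + H\<close> with independent summands, where
  \<open>W\<close> is stationary for the Lindley recursion \<open>W \<mapsto> (W + H - E_s)\<^sup>+\<close> and \<open>V\<close> is uniform on
  \<open>[0, E_s]\<close>. For a set \<open>A\<close> that it charges, the probability of visiting \<open>A\<close> infinitely often is
  harmonic, hence a constant; this constant is positive, and it is \<open>0\<close> or \<open>1\<close> by
  a zero-one law, so it is \<open>1\<close>.\<close>

section \<open>The path law of a Markov kernel\<close>

text \<open>The usual route to Harris recurrence is a drift condition towards a petite set. The
  drift does lead to [0, E], but a minorization there would have to be extracted from convolutions
  of a law of which only absolute continuity is known. Bounded harmonic functions avoid this. A
  density is used in two ways only: single harvest values have probability 0, so a harvest is almost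
  surely nonzero and not a rational multiple of E, and an equality that holds Lebesgue-almost
  everywhere can be averaged over one harvest.

  The uniform summand V comes from the circle: its law is invariant under every rotation, so
  consumption acts on W + H alone, as the truncated subtraction of the Lindley recursion. The mean
  condition enters through the expected time spent above E and through the supremum of the walk with
  steps \<bar>t\<bar> - E.

  The invariant probability does double duty: besides giving positivity, it is itself the maximal
  irreducibility measure against which recurrence is tested.\<close>

primrec fdd_integral ::
    "('a \<Rightarrow> 'a measure) \<Rightarrow> nat \<Rightarrow> (nat \<Rightarrow> 'a set) \<Rightarrow> ('a \<Rightarrow> ennreal) \<Rightarrow> 'a \<Rightarrow> ennreal" where
  "fdd_integral K 0 A g x = indicator (A 0) x * g x"
| "fdd_integral K (Suc n) A g x =
     indicator (A 0) x * (\<integral>\<^sup>+y. fdd_integral K n (\<lambda>i. A (Suc i)) g y \<partial>K x)"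

lemma fdd_measurable:
  assumes K: "transition_kernel S K" and A: "\<And>i. i \<le> n \<Longrightarrow> A i \<in> sets S"
  shows "fdd K n A \<in> borel_measurable S"
  using A
proof (induction n arbitrary: A)
  case 0
  then show ?case by (simp add: fun_eq_iff[of "fdd K 0 A"] cong: measurable_cong)
next
  case (Suc n)
  have "K \<in> S \<rightarrow>\<^sub>M subprob_algebra S"
    using K unfolding transition_kernel_def by (rule measurable_prob_algebraD)
  then have "(\<lambda>x. \<integral>\<^sup>+y. fdd K n (\<lambda>i. A (Suc i)) y \<partial>K x) \<in> borel_measurable S"
    by (rule measurable_compose[OF _ nn_integral_measurable_subprob_algebra]) (rule Suc.IH, simp add: Suc.prems)
  then show ?case using Suc.prems[of 0] by (simp cong: measurable_cong)
qed

lemma fdd_integral_1: "fdd_integral K n A (\<lambda>_. 1) x = fdd K n A x"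
  by (induction n arbitrary: A x) simp_all

text \<open>\<open>fdd\<close> unfolds at the first coordinate, while the Ionescu-Tulcea
  construction appends coordinates at the end. The terminal weight \<open>g\<close> reconciles the
  two: integrating out the last coordinate only replaces it by another weight.\<close>

lemma fdd_integral_Suc_last:
  "fdd_integral K (Suc n) A g x =
     fdd_integral K n A (\<lambda>y. \<integral>\<^sup>+z. indicator (A (Suc n)) z * g z \<partial>K y) x"
proof (induction n arbitrary: A x)
  case (Suc n)
  have "fdd_integral K (Suc (Suc n)) A g x =
      indicator (A 0) x * (\<integral>\<^sup>+y. fdd_integral K (Suc n) (\<lambda>i. A (Suc i)) g y \<partial>K x)"
    by (rule fdd_integral.simps(2))
  then show ?case unfolding Suc.IH by (simp only: fdd_integral.simps(2))
qed simp

text \<open>The prefix measure carries the coordinates 0 to n, coordinate 0 being the point mass at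
  x, so \<open>Suc n\<close> extensions correspond to n kernel steps. The induction strips the last
  extension and therefore has to run over every weight \<open>g\<close>.\<close>

lemma nn_integral_path_prefix:
  fixes K :: "'a \<Rightarrow> 'a measure"
  assumes K: "transition_kernel S K" and x: "x \<in> space S" and A: "\<And>i. i \<le> n \<Longrightarrow> A i \<in> sets S"
    and g: "g \<in> borel_measurable S"
  shows "(\<integral>\<^sup>+\<omega>. (\<Prod>i\<le>n. indicator (A i) (\<omega> i)) * g (\<omega> n)
      \<partial>Ionescu_Tulcea.C (path_step S K x) (\<lambda>_. S) 0 (Suc n) (\<lambda>_. undefined)) =
    fdd_integral K n A g x"
  using A g
proof (induction n arbitrary: g)
  case 0
  interpret IT: Ionescu_Tulcea "path_step S K x" "\<lambda>_. S"
    by (rule Ionescu_Tulcea_path_step[OF K x])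
  have u: "(\<lambda>_. undefined) \<in> space (PiM {0..<0::nat} (\<lambda>_. S))" by (simp add: space_PiM)
  note [measurable] = 0
  have [measurable]: "A 0 \<in> sets S" using 0 by simp
  have "IT.C 0 (Suc 0) (\<lambda>_. undefined) = IT.eP 0 (\<lambda>_. undefined)"
    unfolding IT.C.simps
    by (simp only: add_0_right bind_return[OF IT.measurable_eP u])
  moreover have "(\<integral>\<^sup>+\<omega>. (\<Prod>i\<le>0. indicator (A i) (\<omega> i)) * g (\<omega> 0) \<partial>IT.eP 0 (\<lambda>_. undefined))
     = (\<integral>\<^sup>+z. indicator (A 0) z * g z \<partial>return S x)"
    by (subst IT.nn_integral_eP[OF u]) (simp_all add: path_step_def)
  ultimately show ?case using x by (simp add: nn_integral_return)
next
  case (Suc n)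
  interpret IT: Ionescu_Tulcea "path_step S K x" "\<lambda>_. S"
    by (rule Ionescu_Tulcea_path_step[OF K x])
  have u: "(\<lambda>_. undefined) \<in> space (PiM {0..<0::nat} (\<lambda>_. S))" by (simp add: space_PiM)
  have Km[measurable]: "K \<in> S \<rightarrow>\<^sub>M subprob_algebra S"
    using K unfolding transition_kernel_def by (rule measurable_prob_algebraD)
  note [measurable] = Suc.prems(2)
  have A[measurable]: "A i \<in> sets S" if "i \<le> Suc n" for i using Suc.prems that by simp
  define F where "F = (\<lambda>\<omega>. (\<Prod>i\<le>Suc n. indicator (A i) (\<omega> i)) * g (\<omega> (Suc n)) :: ennreal)"
  have comp: "(\<lambda>\<omega>. \<omega> i) \<in> PiM {0..<Suc (Suc n)} (\<lambda>_. S) \<rightarrow>\<^sub>M S" if "i \<le> Suc n" for i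
    using that by (intro measurable_component_singleton) simp
  have ind: "(\<lambda>\<omega>. indicator (A i) (\<omega> i) :: ennreal) \<in> borel_measurable (PiM {0..<Suc (Suc n)} (\<lambda>_. S))"
    if "i \<le> Suc n" for i
    by (rule measurable_compose[OF comp[OF that] borel_measurable_indicator[OF A[OF that]]])
  have "(\<lambda>\<omega>. \<Prod>i\<le>Suc n. indicator (A i) (\<omega> i) :: ennreal) \<in> borel_measurable (PiM {0..<Suc (Suc n)} (\<lambda>_. S))"
    by (rule borel_measurable_prod_ennreal) (simp add: ind)
  moreover have "(\<lambda>\<omega>. g (\<omega> (Suc n))) \<in> borel_measurable (PiM {0..<Suc (Suc n)} (\<lambda>_. S))"
    by (rule measurable_compose[OF comp[OF order_refl] Suc.prems(2)])
  ultimately have F: "F \<in> borel_measurable (PiM {0..<Suc (Suc n)} (\<lambda>_. S))"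
    unfolding F_def by (rule borel_measurable_times_ennreal)
  define g' where "g' = (\<lambda>y. \<integral>\<^sup>+z. indicator (A (Suc n)) z * g z \<partial>K y)"
  have g'[measurable]: "g' \<in> borel_measurable S"
    unfolding g'_def
    by (rule nn_integral_measurable_subprob_algebra2[OF _ Km]) (use A[of "Suc n"] in simp)
  have eP: "IT.eP (Suc n) \<in> IT.C 0 (Suc n) (\<lambda>_. undefined) \<rightarrow>\<^sub>M subprob_algebra (PiM {0..<Suc (Suc n)} (\<lambda>_. S))"
    using IT.measurable_eP[of "Suc n"]
    by (simp only: measurable_cong_sets[OF IT.sets_C[OF u, of "Suc n"] refl] add_0)
  have "(\<integral>\<^sup>+\<omega>. F \<omega> \<partial>IT.C 0 (Suc (Suc n)) (\<lambda>_. undefined)) =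
      (\<integral>\<^sup>+\<omega>. \<integral>\<^sup>+\<omega>'. F \<omega>' \<partial>IT.eP (Suc n) \<omega> \<partial>IT.C 0 (Suc n) (\<lambda>_. undefined))"
    using nn_integral_bind[OF F eP] by (simp only: IT.C.simps(2) add_0)
  also have "\<dots> = (\<integral>\<^sup>+\<omega>. (\<Prod>i\<le>n. indicator (A i) (\<omega> i)) * g' (\<omega> n) \<partial>IT.C 0 (Suc n) (\<lambda>_. undefined))"
  proof (rule nn_integral_cong)
    fix \<omega> assume "\<omega> \<in> space (IT.C 0 (Suc n) (\<lambda>_. undefined))"
    then have \<omega>: "\<omega> \<in> space (PiM {0..<Suc n} (\<lambda>_. S))" using IT.space_C[OF u, of "Suc n"] by simp
    then have \<omega>n: "\<omega> n \<in> space S" by (auto simp: space_PiM PiE_iff)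
    have Ks: "sets (K (\<omega> n)) = sets S" using subprob_measurableD(2)[OF Km \<omega>n] .
    have m: "(\<lambda>z. indicator (A (Suc n)) z * g z) \<in> borel_measurable (K (\<omega> n))"
      using A[of "Suc n"] by (simp add: measurable_cong_sets[OF Ks refl])
    have "(\<integral>\<^sup>+\<omega>'. F \<omega>' \<partial>IT.eP (Suc n) \<omega>) = (\<integral>\<^sup>+z. F (fun_upd \<omega> (Suc n) z) \<partial>K (\<omega> n))"
      by (subst IT.nn_integral_eP[OF \<omega> F]) (simp add: path_step_def)
    also have "\<dots> = (\<integral>\<^sup>+z. (\<Prod>i\<le>n. indicator (A i) (\<omega> i)) * (indicator (A (Suc n)) z * g z) \<partial>K (\<omega> n))"
      unfolding F_def by (intro nn_integral_cong) (simp add: mult.assoc)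
    also have "\<dots> = (\<Prod>i\<le>n. indicator (A i) (\<omega> i)) * g' (\<omega> n)"
      unfolding g'_def by (rule nn_integral_cmult[OF m])
    finally show "(\<integral>\<^sup>+\<omega>'. F \<omega>' \<partial>IT.eP (Suc n) \<omega>) = (\<Prod>i\<le>n. indicator (A i) (\<omega> i)) * g' (\<omega> n)" .
  qed
  also have "\<dots> = fdd_integral K n A g' x" by (rule Suc.IH) (auto intro: A)
  also have "\<dots> = fdd_integral K (Suc n) A g x" unfolding fdd_integral_Suc_last g'_def ..
  finally show ?case unfolding F_def .
qed

lemma emeasure_path_law_cylinder:
  assumes K: "transition_kernel S K" and x: "x \<in> space S" and A: "\<And>i. i \<le> n \<Longrightarrow> A i \<in> sets S"
  shows "emeasure (path_law S K x) {\<omega> \<in> space (PiM UNIV (\<lambda>_. S)). \<forall>i\<le>n. \<omega> i \<in> A i} = fdd K n A x"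
proof -
  interpret IT: Ionescu_Tulcea "path_step S K x" "\<lambda>_. S"
    by (rule Ionescu_Tulcea_path_step[OF K x])
  have u: "(\<lambda>_. undefined) \<in> space (PiM {0..<0::nat} (\<lambda>_. S))" by (simp add: space_PiM)
  let ?J = "{0..<Suc n}" and ?X = "PiE {0..<Suc n} A" and ?C = "IT.C 0 (Suc n) (\<lambda>_. undefined)"
  have X: "?X \<in> sets (PiM ?J (\<lambda>_. S))" by (rule sets_PiM_I_finite) (auto intro: A)
  have sp: "space ?C = space (PiM ?J (\<lambda>_. S))" using IT.space_C[OF u, of "Suc n"] by simp
  have "{\<omega> \<in> space (PiM UNIV (\<lambda>_. S)). \<forall>i\<le>n. \<omega> i \<in> A i} = IT.PF.emb UNIV ?J ?X"
    by (auto simp: prod_emb_def space_PiM PiE_iff less_Suc_eq_le)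
  then have "emeasure (path_law S K x) {\<omega> \<in> space (PiM UNIV (\<lambda>_. S)). \<forall>i\<le>n. \<omega> i \<in> A i} =
      emeasure (IT.CI ?J) ?X"
    unfolding path_law_def by (simp add: IT.lim[OF _ X])
  also have "\<dots> = emeasure ?C (IT.PF.emb ?J ?J ?X)"
    by (rule IT.emeasure_CI[OF _ X]) simp
  also have "IT.PF.emb ?J ?J ?X = ?X"
    using sets.sets_into_space[OF X] by (intro prod_emb_id) (simp add: space_PiM)
  also have "emeasure ?C ?X = (\<integral>\<^sup>+\<omega>. indicator ?X \<omega> \<partial>?C)"
    using X IT.sets_C[OF u, of "Suc n"] by simp
  also have "\<dots> = (\<integral>\<^sup>+\<omega>. (\<Prod>i\<le>n. indicator (A i) (\<omega> i)) * 1 \<partial>?C)"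
  proof (rule nn_integral_cong)
    fix \<omega> assume "\<omega> \<in> space ?C"
    then have "\<omega> \<in> extensional ?J" unfolding sp by (auto simp: space_PiM PiE_iff)
    then show "indicator ?X \<omega> = (\<Prod>i\<le>n. indicator (A i) (\<omega> i)) * (1::ennreal)"
      by (auto simp: indicator_def PiE_iff less_Suc_eq_le prod_zero_iff)
  qed
  also have "\<dots> = fdd_integral K n A (\<lambda>_. 1) x"
    by (rule nn_integral_path_prefix[OF K x A]) auto
  finally show ?thesis by (simp add: fdd_integral_1)
qed

text \<open>This lets a concrete realisation of the chain replace the projective limit. Initial
  segments are enough because missing coordinates can be filled with the whole space.\<close>

lemma path_law_unique:
  assumes K: "transition_kernel S K" and x: "x \<in> space S"
    and Q: "finite_measure Q" "sets Q = sets (PiM UNIV (\<lambda>_. S))"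
    and cyl: "\<And>n A. (\<And>i. i \<le> n \<Longrightarrow> A i \<in> sets S) \<Longrightarrow>
      emeasure Q {\<omega> \<in> space (PiM UNIV (\<lambda>_. S)). \<forall>i\<le>n. \<omega> i \<in> A i} = fdd K n A x"
  shows "path_law S K x = Q"
proof (rule measure_eqI_PiM_infinite[symmetric, OF Q(2) _ _ Q(1)])
  interpret IT: Ionescu_Tulcea "path_step S K x" "\<lambda>_. S"
    by (rule Ionescu_Tulcea_path_step[OF K x])
  show "sets (path_law S K x) = sets (PiM UNIV (\<lambda>_. S))"
    unfolding path_law_def by simp
  fix A :: "nat \<Rightarrow> 'a set" and J :: "nat set"
  assume J: "finite J" and A: "\<And>i. i \<in> J \<Longrightarrow> A i \<in> sets S"
  obtain n where n: "J \<subseteq> {..n}" using J finite_nat_iff_bounded_le by blast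
  define A' where "A' i = (if i \<in> J then A i else space S)" for i
  have "prod_emb UNIV (\<lambda>_. S) J (PiE J A) = {\<omega> \<in> space (PiM UNIV (\<lambda>_. S)). \<forall>i\<le>n. \<omega> i \<in> A' i}"
    using n by (auto simp: prod_emb_def A'_def space_PiM PiE_iff subset_iff)
  moreover have "A' i \<in> sets S" for i using A by (simp add: A'_def)
  ultimately show "emeasure Q (prod_emb UNIV (\<lambda>_. S) J (PiE J A)) =
      emeasure (path_law S K x) (prod_emb UNIV (\<lambda>_. S) J (PiE J A))"
    using cyl[of n A'] emeasure_path_law_cylinder[OF K x, of n A'] by simp
qed

section \<open>Merging of chains on the same fibre\<close>

text \<open>The absolute value makes every real t an admissible harvest, so [0, \<infinity>) is
  preserved surely and not only almost surely; on nonnegative harvests it changes nothing.\<close>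

definition battery_step :: "real \<Rightarrow> real \<Rightarrow> real \<Rightarrow> real" where
  "battery_step E b t = b + \<bar>t\<bar> - indicator {E<..} b * E"

lemma battery_step_nonneg: "0 < E \<Longrightarrow> 0 \<le> b \<Longrightarrow> 0 \<le> battery_step E b t"
  by (auto simp: battery_step_def indicator_def)

lemma measurable_battery_step[measurable]:
  "(\<lambda>(b, t). battery_step E b t) \<in> borel_measurable (borel \<Otimes>\<^sub>M borel)"
  unfolding battery_step_def by measurable

locale battery = prob_space \<mu> for \<mu> :: "real measure" +
  fixes E :: real
  assumes sets_mu[measurable_cong]: "sets \<mu> = sets borel"
    and E_pos: "0 < E"
    and ac: "absolutely_continuous lborel \<mu>"
    and integrable_mu: "integrable \<mu> (\<lambda>t. \<bar>t\<bar>)"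
    and mean_less: "(\<integral>t. \<bar>t\<bar> \<partial>\<mu>) < E"
begin

lemma space_mu[simp]: "space \<mu> = UNIV"
  using sets_eq_imp_space_eq[OF sets_mu] by simp

lemma prob_UNIV[simp]: "prob UNIV = 1"
  using prob_space by simp

lemma measurable_mu_iff: "f \<in> \<mu> \<rightarrow>\<^sub>M M' \<longleftrightarrow> f \<in> borel \<rightarrow>\<^sub>M M'"
  by (simp add: measurable_cong_sets[OF sets_mu refl])

lemma AE_mu: "AE t in lborel. P t \<Longrightarrow> AE t in \<mu>. P t"
  by (rule absolutely_continuous_AE[OF sets_mu[folded sets_lborel] ac])

lemma AE_mu_ex:
  assumes "AE t in \<mu>. P t"
  shows "\<exists>t. P t"
proof (rule ccontr)
  assume "\<nexists>t. P t"
  with assms have "AE t in \<mu>. False" by simp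
  then show False by (simp only: AE_False)
qed

lemma AE_mu_neq: "AE t in \<mu>. t \<noteq> c"
  by (rule AE_mu) (rule AE_lborel_singleton)

lemma integrable_bounded:
  fixes u :: "real \<Rightarrow> real"
  assumes "u \<in> borel_measurable borel" "\<And>x. \<bar>u x\<bar> \<le> C"
  shows "integrable \<mu> u"
  using assms by (intro integrable_const_bound[where B = C]) (auto simp: measurable_mu_iff)

text \<open>The probability that the chain started at \<open>x\<close> exceeds \<open>E\<close> at all times up to \<open>n\<close>.\<close>

primrec stay_above :: "nat \<Rightarrow> real \<Rightarrow> real" where
  "stay_above 0 x = indicator {E<..} x"
| "stay_above (Suc n) x = indicator {E<..} x * (\<integral>t. stay_above n (battery_step E x t) \<partial>\<mu>)"

lemma stay_above_measurable[measurable]: "stay_above n \<in> borel_measurable borel"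
proof (induction n)
  case (Suc n)
  note Suc[measurable]
  have "(\<lambda>x. indicator {E<..} x * (\<integral>t. stay_above n (battery_step E x t) \<partial>\<mu>)) \<in> borel_measurable borel"
    by measurable
  then show ?case by (simp add: fun_eq_iff[of "stay_above (Suc n)"] cong: measurable_cong)
qed (simp cong: measurable_cong)

lemma stay_above_bounds: "0 \<le> stay_above n x \<and> stay_above n x \<le> 1"
proof (induction n arbitrary: x)
  case (Suc n)
  have "(\<integral>t. stay_above n (battery_step E x t) \<partial>\<mu>) \<le> (\<integral>t. 1 \<partial>\<mu>)"
    using Suc by (intro integral_mono integrable_bounded[where C=1]) auto
  moreover have "0 \<le> (\<integral>t. stay_above n (battery_step E x t) \<partial>\<mu>)"
    using Suc by (intro integral_nonneg_AE) auto
  ultimately show ?case by (auto simp: indicator_def)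
qed (simp add: indicator_def)

lemma integrable_stay_above: "integrable \<mu> (\<lambda>t. stay_above n (battery_step E x t))"
  using stay_above_bounds[of n] by (intro integrable_bounded[where C=1]) auto

text \<open>The level is its own Lyapunov function: above \<open>E\<close> one step lowers its mean
  by \<open>E\<close> minus the mean harvest, and it never becomes negative. The expected time until
  the first entry into [0, E] is paid for by the initial level.\<close>

lemma sum_stay_above_le:
  assumes "0 \<le> x"
  shows "(E - (\<integral>t. \<bar>t\<bar> \<partial>\<mu>)) * (\<Sum>k<n. stay_above k x) \<le> x"
  using assms
proof (induction n arbitrary: x)
  case (Suc n)
  define \<delta> where "\<delta> = E - (\<integral>t. \<bar>t\<bar> \<partial>\<mu>)"
  show ?case
  proof (cases "E < x")
    case True
    have "\<delta> * (\<Sum>k<Suc n. stay_above k x)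
        = \<delta> + (\<integral>t. \<delta> * (\<Sum>k<n. stay_above k (battery_step E x t)) \<partial>\<mu>)"
      using True by (simp add: sum.lessThan_Suc_shift integrable_stay_above Bochner_Integration.integral_sum
          distrib_left del: sum.lessThan_Suc)
    also have "\<dots> \<le> \<delta> + (\<integral>t. battery_step E x t \<partial>\<mu>)"
    proof (intro add_left_mono integral_mono)
      show "integrable \<mu> (battery_step E x)"
        unfolding battery_step_def using integrable_mu by simp
    qed (use Suc.IH[OF battery_step_nonneg[OF E_pos Suc.prems]] integrable_stay_above in
          \<open>simp_all add: \<delta>_def\<close>)
    also have "\<dots> = x"
      unfolding battery_step_def \<delta>_def using True integrable_mu by simp
    finally show ?thesis by (simp add: \<delta>_def)
  next
    case False
    then have "stay_above k x = 0" for k by (cases k) auto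
    with Suc.prems show ?thesis by simp
  qed
qed simp

lemma stay_above_tendsto_0:
  assumes "0 \<le> x"
  shows "(\<lambda>n. stay_above n x) \<longlonglongrightarrow> 0"
proof (rule summable_LIMSEQ_zero, rule summableI_nonneg_bounded)
  fix n
  have "0 < E - (\<integral>t. \<bar>t\<bar> \<partial>\<mu>)" using mean_less by simp
  then show "(\<Sum>k<n. stay_above k x) \<le> x / (E - (\<integral>t. \<bar>t\<bar> \<partial>\<mu>))"
    using sum_stay_above_le[OF assms, of n] by (simp add: pos_le_divide_eq mult.commute)
qed (use stay_above_bounds in auto)

text \<open>The gap changes only when the upper chain consumes and the lower one does not. A strict
  decrease needs 0 < x: from x = 0 with m = 1 the upper chain sits exactly at \<open>E\<close> and
  neither consumes.\<close>

lemma battery_step_shift: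
  assumes "0 \<le> x"
  shows "\<exists>m'. (m' = m \<or> m' = m - 1 \<and> x \<le> E) \<and> (0 < x \<and> x \<le> E \<longrightarrow> m' = m - 1) \<and>
    (\<forall>t. battery_step E (x + real m * E) t = battery_step E x t + real m' * E)"
proof (cases "x \<le> E \<and> E < x + real m * E")
  case True
  then have "1 \<le> m" by (cases m) auto
  then have "real (m - 1) = real m - 1" by simp
  then show ?thesis using True
    by (intro exI[of _ "m - 1"]) (auto simp: battery_step_def algebra_simps)
next
  case False
  \<comment> \<open>For 0 < x \<le> E this case leaves only m = 0, where truncated subtraction gives
    m - 1 = m.\<close>
  have "m = m - 1" if "0 < x" "x \<le> E"
  proof (cases m)
    case (Suc k)
    then have "E \<le> real m * E" using E_pos by (simp add: algebra_simps)
    with that False show ?thesis by auto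
  qed simp
  moreover have "(E < x + real m * E) = (E < x)"
    using False E_pos by (auto intro: order_less_le_trans)
  ultimately show ?thesis
    by (intro exI[of _ m]) (auto simp: battery_step_def indicator_def)
qed

text \<open>Driven by the same harvests, two chains whose distance is a multiple of \<open>E\<close> get closer by
  \<open>E\<close> whenever the lower one does not exceed \<open>E\<close> while the upper one does; so they merge.\<close>

lemma fibre_differences_tendsto_0:
  fixes u :: "nat \<Rightarrow> real \<Rightarrow> real"
  assumes u[measurable]: "\<And>n. u n \<in> borel_measurable borel"
    and bound: "\<And>n x. \<bar>u n x\<bar> \<le> C"
    and rec: "\<And>n x. 0 \<le> x \<Longrightarrow> u (Suc n) x = (\<integral>t. u n (battery_step E x t) \<partial>\<mu>)"
    and x: "0 \<le> x"
  shows "(\<lambda>n. u n x - u n (x + real m * E)) \<longlonglongrightarrow> 0"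
proof -
  \<comment> \<open>A sequence \<open>u\<close> covers two uses: a harmonic function, constant in n,
    and the visit probabilities at time n, needed for uniqueness.\<close>
  define d where "d n m x = ennreal \<bar>u n x - u n (x + real m * E)\<bar>" for n m x
  define lim_d where "lim_d m x = limsup (\<lambda>n. d n m x)" for m x
  have C: "0 \<le> C" using bound[of 0 0] by linarith
  have d_meas[measurable]: "d n m \<in> borel_measurable borel" for n m
    unfolding d_def by measurable
  have lim_d_meas[measurable]: "lim_d m \<in> borel_measurable borel" for m
    unfolding lim_d_def by measurable
  have d_bound: "d n m x \<le> ennreal (2 * C)" for n m x
    unfolding d_def using bound[of n x] bound[of n "x + real m * E"] by (intro ennreal_leI) linarith
  have lim_d_bound: "lim_d m x \<le> ennreal (2 * C)" for m x
    unfolding lim_d_def by (rule Limsup_bounded) (simp add: d_bound)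
  \<comment> \<open>Reverse Fatou, with dominating constant 2C, turns the recursion into
    subinvariance of the limiting discrepancy along the coupled pair.\<close>
  have step: "lim_d m x \<le> (\<integral>\<^sup>+t. lim_d m' (battery_step E x t) \<partial>\<mu>)"
    if x: "0 \<le> x" and m': "\<And>t. battery_step E (x + real m * E) t = battery_step E x t + real m' * E"
    for m m' x
  proof -
    have "lim_d m x = limsup (\<lambda>n. d (Suc n) m x)"
      unfolding lim_d_def using limsup_shift[of "\<lambda>n. d n m x"] by simp
    also have "\<dots> \<le> limsup (\<lambda>n. \<integral>\<^sup>+t. d n m' (battery_step E x t) \<partial>\<mu>)"
    proof (intro Limsup_mono always_eventually allI)
      fix n
      let ?f = "\<lambda>t. u n (battery_step E x t) - u n (battery_step E x t + real m' * E)"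
      have i: "integrable \<mu> (\<lambda>t. u n (battery_step E x t))"
          "integrable \<mu> (\<lambda>t. u n (battery_step E x t + real m' * E))"
        using bound by (auto intro!: integrable_bounded[where C = C])
      have "0 \<le> x + real m * E" using x E_pos by simp
      then have "u (Suc n) x - u (Suc n) (x + real m * E) = (\<integral>t. ?f t \<partial>\<mu>)"
        using x i by (simp add: rec m')
      then have "d (Suc n) m x = ennreal (norm (\<integral>t. ?f t \<partial>\<mu>))" by (simp add: d_def)
      also have "\<dots> \<le> (\<integral>\<^sup>+t. norm (?f t) \<partial>\<mu>)"
        by (rule integral_norm_bound_ennreal) (use i in auto)
      finally show "d (Suc n) m x \<le> (\<integral>\<^sup>+t. d n m' (battery_step E x t) \<partial>\<mu>)"
        by (simp add: d_def)
    qed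
    also have "\<dots> \<le> (\<integral>\<^sup>+t. limsup (\<lambda>n. d n m' (battery_step E x t)) \<partial>\<mu>)"
      by (rule nn_integral_limsup[where w = "\<lambda>_. ennreal (2 * C)"])
        (auto simp: d_bound emeasure_space_1[simplified])
    finally show ?thesis unfolding lim_d_def .
  qed
  have "lim_d m x = 0" if "0 \<le> x" for m x
    using that
  proof (induction m arbitrary: x)
    case 0
    show ?case by (simp add: lim_d_def d_def Limsup_const)
  next
    case (Suc m)
    \<comment> \<open>In (0, E] the gap shrinks at the next step to m multiples of \<open>E\<close>,
      where the induction hypothesis applies.\<close>
    have low: "lim_d (Suc m) x = 0" if x: "0 < x" "x \<le> E" for x
    proof -
      obtain m' where "m' = m" "\<And>t. battery_step E (x + real (Suc m) * E) t = battery_step E x t + real m' * E"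
        using battery_step_shift[of x "Suc m"] x by auto
      with step[of x "Suc m" m'] x have "lim_d (Suc m) x \<le> (\<integral>\<^sup>+t. lim_d m (battery_step E x t) \<partial>\<mu>)" by simp
      also have "\<dots> = 0" using Suc.IH battery_step_nonneg[OF E_pos, of x] x by simp
      finally show ?thesis by simp
    qed
    \<comment> \<open>Only trajectories that have stayed above \<open>E\<close> throughout can still
      contribute; entering (0, E] contributes nothing by \<open>low\<close>.\<close>
    have bnd: "lim_d (Suc m) x \<le> ennreal (2 * C * stay_above n x)" if "0 < x" for n x
      using that
    proof (induction n arbitrary: x)
      case 0
      then show ?case using low[of x] lim_d_bound[of "Suc m" x] by (cases "E < x") auto
    next
      case (Suc n)
      show ?case
      proof (cases "E < x")
        case True
        obtain m' where "m' = Suc m" "\<And>t. battery_step E (x + real (Suc m) * E) t = battery_step E x t + real m' * E"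
          using battery_step_shift[of x "Suc m"] Suc.prems True by auto
        with step[of x "Suc m" m'] Suc.prems
        have "lim_d (Suc m) x \<le> (\<integral>\<^sup>+t. lim_d (Suc m) (battery_step E x t) \<partial>\<mu>)" by simp
        also have "\<dots> \<le> (\<integral>\<^sup>+t. ennreal (2 * C * stay_above n (battery_step E x t)) \<partial>\<mu>)"
          using True by (intro nn_integral_mono Suc.IH) (simp add: battery_step_def add_strict_increasing2)
        also have "\<dots> = ennreal (\<integral>t. 2 * C * stay_above n (battery_step E x t) \<partial>\<mu>)"
          using C stay_above_bounds[of n] integrable_stay_above[of n x]
          by (intro nn_integral_eq_integral) auto
        also have "\<dots> = ennreal (2 * C * stay_above (Suc n) x)" using True by simp
        finally show ?thesis .
      qed (use low[of x] Suc.prems in auto)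
    qed
    have pos: "lim_d (Suc m) x = 0" if "0 < x" for x
    proof -
      have "(\<lambda>n. ennreal (2 * C * stay_above n x)) \<longlonglongrightarrow> ennreal (2 * C * 0)"
        using stay_above_tendsto_0[of x] that by (intro tendsto_ennrealI tendsto_mult_left) auto
      then have "lim_d (Suc m) x \<le> ennreal (2 * C * 0)"
        by (rule LIMSEQ_le_const) (use bnd[OF that] in auto)
      then show ?thesis by simp
    qed
    \<comment> \<open>At 0 the gap need not shrink, but the next state is almost surely positive
      because the harvest law has no atom at 0.\<close>
    show ?case
    proof (cases "x = 0")
      case True
      obtain m' where m': "m' = Suc m \<or> m' = m"
        "\<And>t. battery_step E (x + real (Suc m) * E) t = battery_step E x t + real m' * E"
        using battery_step_shift[of x "Suc m"] Suc.prems by auto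
      have "lim_d (Suc m) x \<le> (\<integral>\<^sup>+t. lim_d m' (battery_step E x t) \<partial>\<mu>)"
        by (rule step[OF Suc.prems m'(2)])
      also have "\<dots> = (\<integral>\<^sup>+t. 0 \<partial>\<mu>)"
        using AE_mu_neq[of 0] by (intro nn_integral_cong_AE, eventually_elim)
          (use m'(1) True pos Suc.IH E_pos in \<open>auto simp: battery_step_def\<close>)
      finally show ?thesis by simp
    qed (use pos[of x] Suc.prems in auto)
  qed
  from this[OF x, of m] have "(\<lambda>n. ennreal \<bar>u n x - u n (x + real m * E)\<bar>) \<longlonglongrightarrow> ennreal 0"
    unfolding lim_d_def d_def ennreal_0 by (rule tendsto_0_if_Limsup_eq_0_ennreal)
  then have "(\<lambda>n. \<bar>u n x - u n (x + real m * E)\<bar>) \<longlonglongrightarrow> 0" by (rule tendsto_ennrealD) auto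
  then show ?thesis by (rule tendsto_rabs_zero_cancel)
qed

end

section \<open>Bounded harmonic functions on the circle\<close>

lemma periodic_int_multiple:
  fixes f :: "real \<Rightarrow> 'a"
  assumes "\<And>x. f (x + E) = f x"
  shows "f (x + of_int j * E) = f x"
proof -
  have n: "f (y + real n * E) = f y" for n y
  proof (induction n)
    case (Suc n)
    then show ?case using assms[of "y + real n * E"] by (simp add: algebra_simps)
  qed simp
  show ?thesis
  proof (cases "0 \<le> j")
    case True
    then show ?thesis using n[of x "nat j"] by simp
  next
    case False
    then show ?thesis using n[of "x + of_int j * E" "nat (- j)"] by simp
  qed
qed

lemma floor_shift_bounds:
  fixes x E :: real
  assumes "0 < E"
  shows "0 \<le> x - of_int \<lfloor>x / E\<rfloor> * E" "x - of_int \<lfloor>x / E\<rfloor> * E < E"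
  using floor_divide_lower[OF assms, of x] floor_divide_upper[OF assms, of x] by (simp_all add: algebra_simps)

text \<open>Rescale f into the nonnegative function 1 + f / (C + 1), where C + 1 is positive even if
  C = 0. As a density it gives every interval its length, hence reproduces Lebesgue measure, and
  uniqueness of densities makes it 1 almost everywhere.\<close>

lemma AE_eq_0_if_interval_integrals_0:
  fixes f :: "real \<Rightarrow> real"
  assumes f[measurable]: "f \<in> borel_measurable borel"
    and bound: "\<And>x. \<bar>f x\<bar> \<le> C"
    and zero: "\<And>a b. a \<le> b \<Longrightarrow> (\<integral>y. indicator {a..b} y * f y \<partial>lborel) = 0"
  shows "AE y in lborel. f y = 0"
proof -
  have C: "0 \<le> C" using bound[of 0] by linarith
  define g where "g y = 1 + f y / (C + 1)" for y
  have g[measurable]: "g \<in> borel_measurable borel" unfolding g_def by measurable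
  have "\<bar>f y / (C + 1)\<bar> \<le> 1" for y
    using bound[of y] C by (simp add: abs_divide divide_le_eq)
  then have g_nonneg: "0 \<le> g y" for y
    unfolding g_def using abs_le_D2[of "f y / (C + 1)" 1] by (simp add: algebra_simps)
  have "lborel = density lborel (\<lambda>y. ennreal (g y))"
  proof (rule lborel_eqI)
    fix l u :: real
    assume "\<And>b. b \<in> Basis \<Longrightarrow> l \<bullet> b \<le> u \<bullet> b"
    then have lu: "l \<le> u" by simp
    have if_: "integrable lborel (\<lambda>y. indicator {l..u} y * f y)"
      using bound by (intro integrableI_bounded_set[where A = "{l..u}" and B = C])
        (auto simp: indicator_def lu)
    have "emeasure (density lborel (\<lambda>y. ennreal (g y))) (box l u) =
        (\<integral>\<^sup>+y. ennreal (g y) * indicator (box l u) y \<partial>lborel)"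
      by (simp add: emeasure_density)
    also have "\<dots> = (\<integral>\<^sup>+y. ennreal (indicator {l..u} y * g y) \<partial>lborel)"
      using AE_lborel_singleton[of l] AE_lborel_singleton[of u]
      by (intro nn_integral_cong_AE, eventually_elim) (auto simp: indicator_def box_real)
    also have "\<dots> = ennreal (\<integral>y. indicator {l..u} y * g y \<partial>lborel)"
    proof (rule nn_integral_eq_integral)
      have "integrable lborel (\<lambda>y. indicator {l..u} y + (indicator {l..u} y * f y) / (C + 1))"
        using if_ lu by (intro Bochner_Integration.integrable_add integrable_divide) auto
      then show "integrable lborel (\<lambda>y. indicator {l..u} y * g y)"
        by (simp add: g_def algebra_simps)
    qed (use g_nonneg in auto)
    also have "(\<integral>y. indicator {l..u} y * g y \<partial>lborel) =
        (\<integral>y. indicator {l..u} y + (indicator {l..u} y * f y) / (C + 1) \<partial>lborel)"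
      by (simp add: g_def algebra_simps)
    also have "\<dots> = u - l" using if_ lu zero[OF lu] by simp
    finally show "emeasure (density lborel (\<lambda>y. ennreal (g y))) (box l u) = ennreal (\<Prod>b\<in>Basis. (u - l) \<bullet> b)"
      by simp
  qed simp
  then have "density lborel (\<lambda>_. 1) = density lborel (\<lambda>y. ennreal (g y))" by (simp add: density_1)
  then have "AE y in lborel. 1 = ennreal (g y)"
    using sigma_finite_measure.density_unique[OF lborel.sigma_finite_measure_axioms, of "\<lambda>_. 1" "\<lambda>y. ennreal (g y)"]
    by simp
  then show ?thesis
  proof eventually_elim
    case (elim y)
    then have "g y = 1" by (metis ennreal_eq_1)
    then show "f y = 0" using C by (simp add: g_def)
  qed
qed

text \<open>Two windows of equal length differ only inside two intervals of length \<bar>u -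
  v\<bar>, one spanned by the left ends and one by the right ends. Averaging over windows thus
  supplies the continuity that a merely measurable function lacks.\<close>

lemma window_integral_lipschitz:
  fixes k :: "real \<Rightarrow> real"
  assumes k[measurable]: "k \<in> borel_measurable borel" and bound: "\<And>x. \<bar>k x\<bar> \<le> C" and e: "0 \<le> \<epsilon>"
  shows "\<bar>(\<integral>y. indicator {u..u+\<epsilon>} y * k y \<partial>lborel) - (\<integral>y. indicator {v..v+\<epsilon>} y * k y \<partial>lborel)\<bar> \<le> 2 * C * \<bar>u - v\<bar>"
proof -
  have C: "0 \<le> C" using bound[of 0] by linarith
  have i: "integrable lborel (\<lambda>y. indicator {a..b} y * k y)" for a b :: real
    using bound by (cases "a \<le> b")
      (auto intro!: integrableI_bounded_set[where A = "{a..b}" and B = C] simp: indicator_def)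
  define a b where "a = min u v" and "b = max u v"
  have ab: "a \<le> b" by (simp add: a_def b_def)
  have "\<bar>(\<integral>y. indicator {u..u+\<epsilon>} y * k y \<partial>lborel) - (\<integral>y. indicator {v..v+\<epsilon>} y * k y \<partial>lborel)\<bar>
      = \<bar>\<integral>y. indicator {u..u+\<epsilon>} y * k y - indicator {v..v+\<epsilon>} y * k y \<partial>lborel\<bar>"
    using i by simp
  also have "\<dots> \<le> (\<integral>y. C * (indicator {a..b} y + indicator {a+\<epsilon>..b+\<epsilon>} y) \<partial>lborel)"
  proof (rule integral_abs_bound_integral)
    fix y
    have "\<bar>indicator {u..u+\<epsilon>} y * k y - indicator {v..v+\<epsilon>} y * k y\<bar>
        = \<bar>indicator {u..u+\<epsilon>} y - indicator {v..v+\<epsilon>} y\<bar> * \<bar>k y\<bar>"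
      by (simp add: abs_mult[symmetric] algebra_simps)
    also have "\<dots> \<le> (indicator {a..b} y + indicator {a+\<epsilon>..b+\<epsilon>} y) * C"
      using bound[of y] e C
      by (intro mult_mono) (auto simp: indicator_def a_def b_def min_def max_def)
    finally show "\<bar>indicator {u..u+\<epsilon>} y * k y - indicator {v..v+\<epsilon>} y * k y\<bar>
        \<le> C * (indicator {a..b} y + indicator {a+\<epsilon>..b+\<epsilon>} y)"
      by (simp add: mult.commute)
  qed (use i ab in auto)
  also have "\<dots> = 2 * C * (b - a)" using ab by (simp add: algebra_simps)
  also have "b - a = \<bar>u - v\<bar>" by (auto simp: a_def b_def min_def max_def)
  finally show ?thesis .
qed

context battery
begin

text \<open>Maximum principle: an average can equal the maximum only if almost every harvest leads
  again to a maximum point. One harvest that is an irrational multiple of \<open>E\<close> then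
  spreads a maximum point densely over the circle.\<close>

lemma continuous_harmonic_constant:
  fixes k :: "real \<Rightarrow> real"
  assumes cont: "continuous_on UNIV k" and per: "\<And>u. k (u + E) = k u"
    and harm: "\<And>u. k u = (\<integral>t. k (u + \<bar>t\<bar>) \<partial>\<mu>)"
  shows "k u = k v"
proof -
  have k_meas[measurable]: "k \<in> borel_measurable borel"
    by (rule borel_measurable_continuous_onI[OF cont])
  have red: "k u = k (u - of_int \<lfloor>u / E\<rfloor> * E)" "u - of_int \<lfloor>u / E\<rfloor> * E \<in> {0..E}" for u
    using periodic_int_multiple[of k E u "- \<lfloor>u / E\<rfloor>"] per floor_shift_bounds[OF E_pos, of u] by auto
  have comp: "compact {0..E}" "{0..E} \<noteq> {}" "continuous_on {0..E} k"
    using E_pos continuous_on_subset[OF cont] by auto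
  obtain u0 where u0: "\<And>u. k u \<le> k u0"
    using continuous_attains_sup[OF comp] red by metis
  obtain u1 where u1: "\<And>u. k u1 \<le> k u"
    using continuous_attains_inf[OF comp] red by metis
  have kb: "\<bar>k u\<bar> \<le> \<bar>k u0\<bar> + \<bar>k u1\<bar>" for u using u0[of u] u1[of u] by linarith
  define Z where "Z = {u. k u = k u0}"
  have "closed Z"
    unfolding Z_def by (rule closed_Collect_eq) (use cont in auto)
  have AE_Z: "AE t in \<mu>. q + \<bar>t\<bar> \<in> Z" if "q \<in> Z" for q
  proof -
    have i: "integrable \<mu> (\<lambda>t. k (q + \<bar>t\<bar>))" using kb by (intro integrable_bounded) auto
    have "(\<integral>t. k u0 - k (q + \<bar>t\<bar>) \<partial>\<mu>) = 0"
      using i that harm[of q] by (simp add: Z_def)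
    then have "AE t in \<mu>. k u0 - k (q + \<bar>t\<bar>) = 0"
      using i u0 by (subst (asm) integral_nonneg_eq_0_iff_AE) auto
    then show ?thesis unfolding Z_def by eventually_elim simp
  qed
  \<comment> \<open>The exceptional null set of harvests depends on the point q. A countable dense
    set of maximum points lets a single t serve all of them; closedness extends this to the whole of
    \<open>Z\<close>.\<close>
  obtain Q where Q: "countable Q" "Q \<subseteq> Z" "Z \<subseteq> closure Q" by (rule separable)
  have "AE t in \<mu>. \<forall>q\<in>Q. q + \<bar>t\<bar> \<in> Z"
    using AE_Z Q by (subst AE_ball_countable) auto
  \<comment> \<open>Both signs are excluded because the translation is by \<bar>t\<bar>.\<close>
  moreover have "AE t in \<mu>. \<forall>r\<in>\<rat>. t \<noteq> r * E \<and> t \<noteq> - r * E"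
    by (subst AE_ball_countable) (auto simp: countable_rat AE_mu_neq)
  ultimately have "AE t in \<mu>. (\<forall>q\<in>Q. q + \<bar>t\<bar> \<in> Z) \<and> (\<forall>r\<in>\<rat>. t \<noteq> r * E \<and> t \<noteq> - r * E)"
    by eventually_elim auto
  then obtain t where tQ: "\<And>q. q \<in> Q \<Longrightarrow> q + \<bar>t\<bar> \<in> Z"
      and t: "\<And>r. r \<in> \<rat> \<Longrightarrow> t \<noteq> r * E \<and> t \<noteq> - r * E"
    by (blast dest: AE_mu_ex)
  define \<theta> where "\<theta> = \<bar>t\<bar> / E"
  have \<theta>: "\<theta> \<notin> \<rat>"
  proof
    assume "\<theta> \<in> \<rat>"
    from t[OF this] show False using E_pos by (auto simp: \<theta>_def abs_if split: if_splits)
  qed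
  have tZ: "z + \<bar>t\<bar> \<in> Z" if "z \<in> Z" for z
  proof -
    have "closure Q \<subseteq> {z. z + \<bar>t\<bar> \<in> Z}"
    proof (rule closure_minimal)
      have "{z. z + \<bar>t\<bar> \<in> Z} = {z. k (z + \<bar>t\<bar>) = k u0}" by (simp add: Z_def)
      moreover have "closed {z. k (z + \<bar>t\<bar>) = k u0}"
        by (rule closed_Collect_eq)
          (auto intro!: continuous_on_compose2[OF cont] continuous_intros)
      ultimately show "closed {z. z + \<bar>t\<bar> \<in> Z}" by simp
    qed (use tQ in auto)
    with Q(3) that show ?thesis by auto
  qed
  have nZ: "u0 + real n * \<bar>t\<bar> \<in> Z" for n
  proof (induction n)
    case 0 then show ?case by (simp add: Z_def)
  next
    case (Suc n)
    from tZ[OF this] show ?case by (simp add: algebra_simps)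
  qed
  have "v \<in> closure Z" for v
  proof (unfold closure_approachable, intro allI impI)
    fix \<epsilon> :: real assume "0 < \<epsilon>"
    then have e: "0 < \<epsilon> / E" using E_pos by simp
    \<comment> \<open>Kronecker density. The multiplier n has to be positive, since \<open>Z\<close>
      is only known to be stable under forward translation by \<bar>t\<bar>.\<close>
    obtain h n where n: "0 < n" "\<bar>of_int n * \<theta> - of_int h - (v - u0) / E\<bar> < \<epsilon> / E"
      by (rule sequence_of_fractional_parts_is_dense[OF \<theta> e])
    define y where "y = u0 + of_int n * \<bar>t\<bar> + of_int (- h) * E"
    have "k y = k (u0 + real (nat n) * \<bar>t\<bar>)"
      unfolding y_def by (subst periodic_int_multiple[of k E]) (use per n in auto)
    then have "y \<in> Z" using nZ[of "nat n"] by (simp add: Z_def)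
    moreover have "y - v = (of_int n * \<theta> - of_int h - (v - u0) / E) * E"
      using E_pos by (simp add: y_def \<theta>_def field_simps)
    then have "dist y v < \<epsilon>"
      using n(2) E_pos by (simp add: dist_real_def abs_mult pos_less_divide_eq)
    ultimately show "\<exists>y\<in>Z. dist y v < \<epsilon>" by blast
  qed
  then have "k w = k u0" for w using \<open>closed Z\<close> by (simp add: Z_def)
  from this[of u] this[of v] show ?thesis by simp
qed

text \<open>Window averages of \<open>k\<close> are continuous, periodic and again harmonic, hence
  constant. So \<open>k\<close> agrees Lebesgue-almost everywhere with each of its translates, and
  averaging over one harvest, whose law has a density, upgrades this to equality at every
  point.\<close>

lemma harmonic_periodic_constant:
  fixes k :: "real \<Rightarrow> real"
  assumes k[measurable]: "k \<in> borel_measurable borel" and bound: "\<And>x. \<bar>k x\<bar> \<le> C"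
    and per: "\<And>u. k (u + E) = k u" and harm: "\<And>u. k u = (\<integral>t. k (u + \<bar>t\<bar>) \<partial>\<mu>)"
  shows "k u = k v"
proof -
  have C: "0 \<le> C" using bound[of 0] by linarith
  have i: "integrable lborel (\<lambda>y. indicator {a..b} y * k (c + y))" for a b c :: real
    using bound by (cases "a \<le> b")
      (auto intro!: integrableI_bounded_set[where A = "{a..b}" and B = C] simp: indicator_def)
  define G where "G \<epsilon> u = (\<integral>y. indicator {u..u+\<epsilon>} y * k y \<partial>lborel)" for \<epsilon> u :: real
  have G_shift: "G \<epsilon> u = (\<integral>s. indicator {0..\<epsilon>} s * k (u + s) \<partial>lborel)" for \<epsilon> u
    unfolding G_def
    by (subst lborel_integral_real_affine[where c = 1 and t = u])
      (auto intro!: Bochner_Integration.integral_cong simp: indicator_def)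
  have G_const: "G \<epsilon> u = G \<epsilon> v" if \<epsilon>: "0 \<le> \<epsilon>" for \<epsilon> u v
  proof (rule continuous_harmonic_constant[where k = "G \<epsilon>"])
    have "(2 * C)-lipschitz_on UNIV (G \<epsilon>)"
      using window_integral_lipschitz[OF k bound \<epsilon>] C
      by (intro lipschitz_onI) (auto simp: G_def dist_real_def)
    then show "continuous_on UNIV (G \<epsilon>)" by (rule lipschitz_on_continuous_on)
    show "G \<epsilon> (u + E) = G \<epsilon> u" for u
      using per[of "u + _"] by (simp add: G_shift algebra_simps)
    fix u
    interpret P: pair_sigma_finite \<mu> "lborel :: real measure" ..
    let ?f = "\<lambda>t s. indicator {0..\<epsilon>} s * k (u + \<bar>t\<bar> + s)"
    have "integrable (\<mu> \<Otimes>\<^sub>M lborel) (case_prod ?f)"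
    proof (rule integrableI_bounded_set[where A = "UNIV \<times> {0..\<epsilon>}" and B = C])
      show "emeasure (\<mu> \<Otimes>\<^sub>M lborel) (UNIV \<times> {0..\<epsilon>}) < \<infinity>"
        using \<epsilon> emeasure_space_1
        by (subst lborel.emeasure_pair_measure_Times) (auto simp: sets_mu)
    qed (use bound in \<open>auto simp: sets_mu indicator_def\<close>)
    from P.Fubini_integral[OF this]
    have "(\<integral>t. G \<epsilon> (u + \<bar>t\<bar>) \<partial>\<mu>) = (\<integral>s. indicator {0..\<epsilon>} s * (\<integral>t. k ((u + s) + \<bar>t\<bar>) \<partial>\<mu>) \<partial>lborel)"
      unfolding G_shift by (simp add: add_ac)
    also have "\<dots> = G \<epsilon> u" unfolding G_shift harm[symmetric] ..
    finally show "G \<epsilon> u = (\<integral>t. G \<epsilon> (u + \<bar>t\<bar>) \<partial>\<mu>)" ..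
  qed
  define s where "s = v - u"
  have "AE y in lborel. k (y + s) - k y = 0"
  proof (rule AE_eq_0_if_interval_integrals_0)
    show "\<bar>k (y + s) - k y\<bar> \<le> 2 * C" for y using bound[of "y + s"] bound[of y] by linarith
    fix a b :: real assume "a \<le> b"
    have "(\<integral>y. indicator {a..b} y * (k (y + s) - k y) \<partial>lborel) =
        (\<integral>y. indicator {a..b} y * k (s + y) \<partial>lborel) - (\<integral>y. indicator {a..b} y * k (0 + y) \<partial>lborel)"
      using i[of a b s] i[of a b 0]
      by (subst Bochner_Integration.integral_diff[symmetric]) (simp_all add: algebra_simps)
    also have "(\<integral>y. indicator {a..b} y * k (s + y) \<partial>lborel) = G (b - a) (s + a)"
      unfolding G_def
      by (subst (2) lborel_integral_real_affine[where c = 1 and t = s])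
        (auto intro!: Bochner_Integration.integral_cong simp: indicator_def)
    also have "(\<integral>y. indicator {a..b} y * k (0 + y) \<partial>lborel) = G (b - a) a"
      unfolding G_def by simp
    also have "G (b - a) (s + a) = G (b - a) a" using \<open>a \<le> b\<close> by (intro G_const) simp
    finally show "(\<integral>y. indicator {a..b} y * (k (y + s) - k y) \<partial>lborel) = 0" by simp
  qed measurable
  \<comment> \<open>The null set is pulled back along u + t and along u - t, since \<bar>t\<bar> is
    one or the other of t and -t.\<close>
  note ae = AE_borel_affine[OF _ _ this]
  have "AE t in \<mu>. k (u + \<bar>t\<bar> + s) = k (u + \<bar>t\<bar>)"
    using AE_mu[OF ae[of 1 u]] AE_mu[OF ae[of "- 1" u]]
    by (auto simp: abs_if algebra_simps)
  then have "(\<integral>t. k (v + \<bar>t\<bar>) \<partial>\<mu>) = (\<integral>t. k (u + \<bar>t\<bar>) \<partial>\<mu>)"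
    by (intro integral_cong_AE) (auto simp: s_def algebra_simps measurable_mu_iff)
  with harm[of u] harm[of v] show ?thesis by linarith
qed

end

section \<open>Trajectories driven by a stream of harvests\<close>

text \<open>Recursing on the initial state, and not appending a last step, makes the Markov property
  at time 1 definitional: along \<open>t ## \<omega>\<close> the path continues along
  \<open>\<omega>\<close> from the state after harvest t.\<close>

primrec battery_path :: "real \<Rightarrow> real \<Rightarrow> nat \<Rightarrow> real stream \<Rightarrow> real" where
  "battery_path E x 0 \<omega> = x"
| "battery_path E x (Suc n) \<omega> = battery_path E (battery_step E x (shd \<omega>)) n (stl \<omega>)"

lemma battery_path_nonneg: "0 < E \<Longrightarrow> 0 \<le> x \<Longrightarrow> 0 \<le> battery_path E x n \<omega>"
  by (induction n arbitrary: x \<omega>) (auto intro: battery_step_nonneg)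

lemma measurable_battery_path[measurable]:
  "(\<lambda>(x, \<omega>). battery_path E x n \<omega>) \<in> borel_measurable (borel \<Otimes>\<^sub>M stream_space borel)"
proof (induction n)
  case (Suc n)
  have "(\<lambda>(x, \<omega>). (battery_step E x (shd \<omega>), stl \<omega>)) \<in>
      borel \<Otimes>\<^sub>M stream_space borel \<rightarrow>\<^sub>M borel \<Otimes>\<^sub>M stream_space borel"
    by measurable
  from measurable_compose[OF this Suc] show ?case by (simp add: case_prod_beta)
qed simp

lemma space_battery_space[simp]: "space battery_space = {0..}"
  by (simp add: battery_space_def space_restrict_space)

lemma sets_battery_space: "A \<in> sets battery_space \<longleftrightarrow> A \<in> sets borel \<and> A \<subseteq> {0..}"
  by (auto simp: battery_space_def sets_restrict_space_iff)

lemma measurable_battery_spaceI: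
  "f \<in> borel_measurable N \<Longrightarrow> (\<And>x. x \<in> space N \<Longrightarrow> 0 \<le> f x) \<Longrightarrow> f \<in> N \<rightarrow>\<^sub>M battery_space"
  unfolding battery_space_def by (intro measurable_restrict_space2) auto

lemma pred_component: "A \<in> sets S \<Longrightarrow> Measurable.pred (PiM UNIV (\<lambda>_. S)) (\<lambda>\<omega>. \<omega> n \<in> A)"
  by (rule pred_sets2[OF _ measurable_component_singleton]) simp_all

lemma measurable_from_battery_space: "f \<in> borel \<rightarrow>\<^sub>M N \<Longrightarrow> f \<in> battery_space \<rightarrow>\<^sub>M N"
  unfolding battery_space_def by (rule measurable_restrict_space1)

context battery
begin

abbreviation "chain_kernel \<equiv> battery_kernel \<mu> abs E"
abbreviation "harvests \<equiv> stream_space \<mu>"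

sublocale harvests: prob_space harvests
  by (rule prob_space_stream_space)

lemma space_harvests[simp]: "space harvests = UNIV"
  by (simp add: space_stream_space)

lemma sets_harvests[measurable_cong]: "sets harvests = sets (stream_space borel)"
  by (rule sets_stream_space_cong[OF sets_mu])

lemma kernel_eq: "chain_kernel x = distr \<mu> battery_space (battery_step E x)"
  by (simp add: battery_kernel_def battery_step_def[abs_def])

lemma measurable_step_battery_space: "0 \<le> x \<Longrightarrow> battery_step E x \<in> \<mu> \<rightarrow>\<^sub>M battery_space"
  by (intro measurable_battery_spaceI battery_step_nonneg[OF E_pos]) auto

lemma nn_integral_kernel:
  "0 \<le> x \<Longrightarrow> g \<in> borel_measurable battery_space \<Longrightarrow>
    (\<integral>\<^sup>+y. g y \<partial>chain_kernel x) = (\<integral>\<^sup>+t. g (battery_step E x t) \<partial>\<mu>)"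
  unfolding kernel_eq by (subst nn_integral_distr[OF measurable_step_battery_space]) simp_all

lemma transition_kernel_battery: "transition_kernel battery_space chain_kernel"
  unfolding transition_kernel_def
proof (rule measurable_prob_algebraI)
  show "prob_space (chain_kernel x)" if "x \<in> space battery_space" for x
    unfolding kernel_eq using that by (intro prob_space_distr measurable_step_battery_space) simp
  have "(\<lambda>x. distr \<mu> battery_space (battery_step E x)) \<in> battery_space \<rightarrow>\<^sub>M subprob_algebra battery_space"
  proof (rule measurable_distr2)
    have [measurable]: "(\<lambda>x. x) \<in> battery_space \<rightarrow>\<^sub>M borel"
      by (rule measurable_from_battery_space) simp
    show "case_prod (battery_step E) \<in> battery_space \<Otimes>\<^sub>M \<mu> \<rightarrow>\<^sub>M battery_space"
    proof (rule measurable_battery_spaceI)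
      have "(\<lambda>p. battery_step E (fst p) (snd p)) \<in> borel_measurable (battery_space \<Otimes>\<^sub>M \<mu>)"
        by measurable
      then show "case_prod (battery_step E) \<in> borel_measurable (battery_space \<Otimes>\<^sub>M \<mu>)"
        by (simp add: case_prod_beta')
    qed (auto simp: space_pair_measure intro: battery_step_nonneg[OF E_pos])
    show "(\<lambda>x. \<mu>) \<in> battery_space \<rightarrow>\<^sub>M subprob_algebra \<mu>"
      using prob_space_axioms by (intro measurable_const)
        (simp add: space_subprob_algebra prob_space_imp_subprob_space)
  qed
  then show "chain_kernel \<in> battery_space \<rightarrow>\<^sub>M subprob_algebra battery_space"
    by (simp add: kernel_eq[abs_def])
qed

lemma measurable_path[measurable (raw)]:
  assumes [measurable]: "f \<in> borel_measurable N" and g: "g \<in> N \<rightarrow>\<^sub>M harvests"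
  shows "(\<lambda>z. battery_path E (f z) n (g z)) \<in> borel_measurable N"
proof -
  have [measurable]: "g \<in> N \<rightarrow>\<^sub>M stream_space borel"
    using g by (simp only: measurable_cong_sets[OF refl sets_harvests])
  show ?thesis by measurable
qed

lemma measurable_path_from[measurable]: "battery_path E x n \<in> borel_measurable harvests"
  by (rule measurable_path) simp_all

lemma pred_path: "A \<in> sets borel \<Longrightarrow> Measurable.pred harvests (\<lambda>\<omega>. battery_path E x n \<omega> \<in> A)"
  by (rule pred_sets2[OF _ measurable_path_from])

lemma emeasure_path_cylinder:
  assumes "0 \<le> x" and A: "\<And>i. i \<le> n \<Longrightarrow> A i \<in> sets battery_space"
  shows "emeasure harvests {\<omega>. \<forall>i\<le>n. battery_path E x i \<omega> \<in> A i} = fdd chain_kernel n A x"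
  using assms
proof (induction n arbitrary: x A)
  case 0
  then show ?case using harvests.emeasure_space_1 by (auto simp: indicator_def)
next
  case (Suc n)
  have A: "A i \<in> sets borel" if "i \<le> Suc n" for i using Suc.prems(2)[OF that] by (simp add: sets_battery_space)
  have "emeasure harvests {\<omega>. \<forall>i\<le>Suc n. battery_path E x i \<omega> \<in> A i} =
      (\<integral>\<^sup>+t. emeasure harvests {\<omega>. \<forall>i\<le>Suc n. battery_path E x i (t ## \<omega>) \<in> A i} \<partial>\<mu>)"
  proof (subst emeasure_stream_space)
    have "{\<omega> \<in> space harvests. \<forall>i\<in>{..Suc n}. battery_path E x i \<omega> \<in> A i} \<in> sets harvests"
      by (intro sets.sets_Collect_finite_All) (use pred_path[OF A] in \<open>auto simp: pred_def\<close>)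
    then show "{\<omega>. \<forall>i\<le>Suc n. battery_path E x i \<omega> \<in> A i} \<in> sets harvests" by (simp add: Ball_def)
  qed simp
  also have "\<dots> = (\<integral>\<^sup>+t. indicator (A 0) x *
      emeasure harvests {\<omega>. \<forall>i\<le>n. battery_path E (battery_step E x t) i \<omega> \<in> A (Suc i)} \<partial>\<mu>)"
    by (intro nn_integral_cong) (auto simp: all_simps indicator_def less_Suc_eq_le[symmetric] All_less_Suc2)
  also have "\<dots> = (\<integral>\<^sup>+t. indicator (A 0) x * fdd chain_kernel n (\<lambda>i. A (Suc i)) (battery_step E x t) \<partial>\<mu>)"
    using Suc.prems by (intro nn_integral_cong) (simp add: Suc.IH battery_step_nonneg[OF E_pos])
  also have "\<dots> = indicator (A 0) x * (\<integral>\<^sup>+t. fdd chain_kernel n (\<lambda>i. A (Suc i)) (battery_step E x t) \<partial>\<mu>)"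
    using Suc.prems
    by (intro nn_integral_cmult measurable_compose[OF measurable_step_battery_space]
          fdd_measurable transition_kernel_battery) auto
  also have "(\<integral>\<^sup>+t. fdd chain_kernel n (\<lambda>i. A (Suc i)) (battery_step E x t) \<partial>\<mu>) =
      (\<integral>\<^sup>+y. fdd chain_kernel n (\<lambda>i. A (Suc i)) y \<partial>chain_kernel x)"
    using Suc.prems by (intro nn_integral_kernel[symmetric] fdd_measurable transition_kernel_battery) auto
  finally show ?case by simp
qed

lemma measurable_paths:
  "0 \<le> x \<Longrightarrow> (\<lambda>\<omega> n. battery_path E x n \<omega>) \<in> harvests \<rightarrow>\<^sub>M PiM UNIV (\<lambda>_. battery_space)"
  by (intro measurable_PiM_single' measurable_battery_spaceI battery_path_nonneg[OF E_pos])
    (auto simp: battery_path_nonneg[OF E_pos])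

lemma emeasure_distr_paths:
  assumes x: "0 \<le> x" and "{\<omega> \<in> space (PiM UNIV (\<lambda>_. battery_space)). P \<omega>} \<in> sets (PiM UNIV (\<lambda>_. battery_space))"
  shows "emeasure (distr harvests (PiM UNIV (\<lambda>_. battery_space)) (\<lambda>\<omega> n. battery_path E x n \<omega>))
      {\<omega> \<in> space (PiM UNIV (\<lambda>_. battery_space)). P \<omega>} =
      emeasure harvests {\<omega>. P (\<lambda>n. battery_path E x n \<omega>)}"
proof -
  have "(\<lambda>\<omega> n. battery_path E x n \<omega>) -` {\<omega> \<in> space (PiM UNIV (\<lambda>_. battery_space)). P \<omega>} \<inter> space harvests
      = {\<omega>. P (\<lambda>n. battery_path E x n \<omega>)}"
    using battery_path_nonneg[OF E_pos x] by (auto simp: space_PiM)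
  then show ?thesis using assms(2) by (simp only: emeasure_distr[OF measurable_paths[OF x]])
qed

text \<open>From here on, probabilities of the chain are measures of events of harvest streams, with
  the starting point a parameter of the event. Measurability in that parameter and first-step
  decompositions then come from the stream space.\<close>

lemma path_law_eq:
  assumes x: "0 \<le> x"
  shows "path_law battery_space chain_kernel x =
    distr harvests (PiM UNIV (\<lambda>_. battery_space)) (\<lambda>\<omega> n. battery_path E x n \<omega>)"
proof (rule path_law_unique[OF transition_kernel_battery])
  show "finite_measure (distr harvests (PiM UNIV (\<lambda>_. battery_space)) (\<lambda>\<omega> n. battery_path E x n \<omega>))"
    by (rule harvests.finite_measure_distr[OF measurable_paths[OF x]])
  fix n and A :: "nat \<Rightarrow> real set"
  assume A: "\<And>i. i \<le> n \<Longrightarrow> A i \<in> sets battery_space"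
  have "{\<omega> \<in> space (PiM UNIV (\<lambda>_. battery_space)). \<forall>i\<in>{..n}. \<omega> i \<in> A i} \<in> sets (PiM UNIV (\<lambda>_. battery_space))"
    by (intro sets.sets_Collect_finite_All) (use pred_component[OF A] in \<open>auto simp: pred_def\<close>)
  then have "{\<omega> \<in> space (PiM UNIV (\<lambda>_. battery_space)). \<forall>i\<le>n. \<omega> i \<in> A i} \<in> sets (PiM UNIV (\<lambda>_. battery_space))"
    by (simp only: Ball_def atMost_iff)
  from emeasure_distr_paths[OF x this] emeasure_path_cylinder[OF x A]
  show "emeasure (distr harvests (PiM UNIV (\<lambda>_. battery_space)) (\<lambda>\<omega> n. battery_path E x n \<omega>))
      {\<omega> \<in> space (PiM UNIV (\<lambda>_. battery_space)). \<forall>i\<le>n. \<omega> i \<in> A i} = fdd chain_kernel n A x" by simp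
qed (use x in auto)

lemma return_prob_eq:
  assumes x: "0 \<le> x" and A: "A \<in> sets battery_space"
  shows "return_prob battery_space chain_kernel x A =
    emeasure harvests {\<omega>. \<exists>n\<ge>1. battery_path E x n \<omega> \<in> A}"
proof -
  let ?P = "PiM UNIV (\<lambda>_. battery_space) :: (nat \<Rightarrow> real) measure"
  have "{\<omega> \<in> space ?P. \<exists>n\<ge>1. \<omega> n \<in> A} = (\<Union>n\<in>{1..}. {\<omega> \<in> space ?P. \<omega> n \<in> A})" by auto
  also have "\<dots> \<in> sets ?P"
    using predE[OF pred_component[OF A]] by (intro sets.countable_UN') auto
  finally show ?thesis
    unfolding return_prob_def path_law_eq[OF x] space_distr by (rule emeasure_distr_paths[OF x])
qed

lemma infinitely_often_prob_eq:
  assumes x: "0 \<le> x" and A: "A \<in> sets battery_space"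
  shows "infinitely_often_prob battery_space chain_kernel x A =
    emeasure harvests {\<omega>. \<exists>\<^sub>\<infinity>n. battery_path E x n \<omega> \<in> A}"
proof -
  let ?P = "PiM UNIV (\<lambda>_. battery_space) :: (nat \<Rightarrow> real) measure"
  \<comment> \<open>The occupation number omits time 0, which cannot affect whether it is
    infinite.\<close>
  have inf: "infinite {n. n \<ge> 1 \<and> Q n} \<longleftrightarrow> (\<exists>\<^sub>\<infinity>n. Q n)" for Q :: "nat \<Rightarrow> bool"
  proof -
    have "{n. Q n} \<subseteq> insert 0 {n. n \<ge> 1 \<and> Q n}" by (auto simp: not_less_eq_eq)
    then have "finite {n. n \<ge> 1 \<and> Q n} \<longleftrightarrow> finite {n. Q n}"
      by (metis (no_types, lifting) finite_insert mem_Collect_eq rev_finite_subset subsetI)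
    then show ?thesis by (simp add: Inf_many_def)
  qed
  have "{\<omega> \<in> space ?P. \<exists>\<^sub>\<infinity>n. \<omega> n \<in> A} = (\<Inter>m. \<Union>n\<in>{m..}. {\<omega> \<in> space ?P. \<omega> n \<in> A})"
    unfolding INFM_nat_le by auto
  also have "\<dots> \<in> sets ?P"
    using predE[OF pred_component[OF A]] by (intro sets.countable_INT' sets.countable_UN' image_subsetI) auto
  finally show ?thesis
    unfolding infinitely_often_prob_def path_law_eq[OF x] space_distr inf by (rule emeasure_distr_paths[OF x])
qed

end

section \<open>Existence of an invariant probability measure\<close>

text \<open>The supremum of the random walk with steps \<open>\<bar>t\<bar> - E\<close> over the first \<open>n\<close> steps, as a recursion
  from the front.\<close>

primrec max_walk :: "real \<Rightarrow> nat \<Rightarrow> real stream \<Rightarrow> real" where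
  "max_walk E 0 \<omega> = 0"
| "max_walk E (Suc n) \<omega> = max 0 (max_walk E n (stl \<omega>) + \<bar>shd \<omega>\<bar> - E)"

lemma max_walk_nonneg: "0 \<le> max_walk E n \<omega>"
  by (cases n) auto

lemma max_walk_Suc_ge: "max_walk E n \<omega> \<le> max_walk E (Suc n) \<omega>"
proof (induction n arbitrary: \<omega>)
  case (Suc n)
  from Suc[of "stl \<omega>"] show ?case by (simp add: max_def)
qed simp

text \<open>The sequence is monotone, so convergence means boundedness, and a single harvest cannot
  change that. This shift invariance is what makes conditioning on a finite supremum compatible with
  the Lindley recursion.\<close>

lemma convergent_max_walk_stl:
  "convergent (\<lambda>n. max_walk E n \<omega>) \<longleftrightarrow> convergent (\<lambda>n. max_walk E n (stl \<omega>))"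
proof
  assume "convergent (\<lambda>n. max_walk E n \<omega>)"
  then have "Bseq (\<lambda>n. max_walk E n \<omega>)" by (rule convergent_imp_Bseq)
  then obtain B where B: "\<And>n. norm (max_walk E n \<omega>) \<le> B" by (auto simp: Bseq_def)
  have "max_walk E n (stl \<omega>) \<le> B + \<bar>E\<bar>" for n
    using B[of "Suc n"] by auto
  then have "Bseq (\<lambda>n. max_walk E n (stl \<omega>))"
    using max_walk_nonneg[of E _ "stl \<omega>"] by (intro BseqI'[where K = "B + \<bar>E\<bar>"]) simp
  then show "convergent (\<lambda>n. max_walk E n (stl \<omega>))"
    by (rule Bseq_mono_convergent) (auto intro: lift_Suc_mono_le max_walk_Suc_ge)
next
  assume "convergent (\<lambda>n. max_walk E n (stl \<omega>))"
  then obtain L where "(\<lambda>n. max_walk E n (stl \<omega>)) \<longlonglongrightarrow> L" by (auto simp: convergent_def)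
  then have "(\<lambda>n. max_walk E (Suc n) \<omega>) \<longlonglongrightarrow> max 0 (L + \<bar>shd \<omega>\<bar> - E)"
    unfolding max_walk.simps by (intro tendsto_intros)
  then show "convergent (\<lambda>n. max_walk E n \<omega>)"
    unfolding convergent_def by (subst (asm) filterlim_sequentially_Suc) blast
qed

lemma lim_max_walk_stl:
  assumes "convergent (\<lambda>n. max_walk E n \<omega>)"
  shows "lim (\<lambda>n. max_walk E n \<omega>) = max 0 (lim (\<lambda>n. max_walk E n (stl \<omega>)) + \<bar>shd \<omega>\<bar> - E)"
proof -
  have "convergent (\<lambda>n. max_walk E n (stl \<omega>))" using assms convergent_max_walk_stl by blast
  then have "(\<lambda>n. max_walk E n (stl \<omega>)) \<longlonglongrightarrow> lim (\<lambda>n. max_walk E n (stl \<omega>))"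
    by (simp add: convergent_LIMSEQ_iff)
  then have "(\<lambda>n. max_walk E (Suc n) \<omega>) \<longlonglongrightarrow> max 0 (lim (\<lambda>n. max_walk E n (stl \<omega>)) + \<bar>shd \<omega>\<bar> - E)"
    unfolding max_walk.simps by (intro tendsto_intros)
  then show ?thesis
    by (subst (asm) filterlim_sequentially_Suc) (rule limI)
qed

lemma measurable_max_walk[measurable]: "max_walk E n \<in> borel_measurable (stream_space borel)"
proof (induction n)
  case (Suc n)
  note Suc[measurable]
  have "(\<lambda>\<omega>. max 0 (max_walk E n (stl \<omega>) + \<bar>shd \<omega>\<bar> - E)) \<in> borel_measurable (stream_space borel)"
    by measurable
  then show ?case by (simp add: fun_eq_iff[of "max_walk E (Suc n)"] cong: measurable_cong)
qed (simp cong: measurable_cong)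

context battery
begin

lemma nn_integral_max_walk_finite: "(\<integral>\<^sup>+\<omega>. ennreal (max_walk E n \<omega>) \<partial>harvests) < \<infinity>"
proof (induction n)
  case (Suc n)
  have "(\<integral>\<^sup>+\<omega>. ennreal (max_walk E (Suc n) \<omega>) \<partial>harvests) =
      (\<integral>\<^sup>+t. \<integral>\<^sup>+\<omega>. ennreal (max_walk E (Suc n) (t ## \<omega>)) \<partial>harvests \<partial>\<mu>)"
    by (subst nn_integral_stream_space) simp_all
  also have "\<dots> \<le> (\<integral>\<^sup>+t. \<integral>\<^sup>+\<omega>. ennreal \<bar>t\<bar> + ennreal (max_walk E n \<omega>) \<partial>harvests \<partial>\<mu>)"
  proof (intro nn_integral_mono)
    fix t \<omega>
    have "max_walk E (Suc n) (t ## \<omega>) \<le> \<bar>t\<bar> + max_walk E n \<omega>"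
      using E_pos max_walk_nonneg[of E n \<omega>] by simp
    from ennreal_leI[OF this]
    show "ennreal (max_walk E (Suc n) (t ## \<omega>)) \<le> ennreal \<bar>t\<bar> + ennreal (max_walk E n \<omega>)"
      by (simp only: ennreal_plus[OF abs_ge_zero max_walk_nonneg])
  qed
  also have "\<dots> = (\<integral>\<^sup>+t. ennreal \<bar>t\<bar> \<partial>\<mu>) + (\<integral>\<^sup>+\<omega>. ennreal (max_walk E n \<omega>) \<partial>harvests)"
    using emeasure_space_1 harvests.emeasure_space_1 by (simp add: nn_integral_add)
  also have "\<dots> < \<infinity>"
    using Suc integrable_mu by (simp add: nn_integral_eq_integral ennreal_add_less_top)
  finally show ?case .
qed simp

text \<open>Compare means over one step. The mean of the maximum does not decrease in n; yet each
  step adds the mean harvest, removes \<open>E\<close>, and gains back by truncation at most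
  \<open>E\<close>, and only when the old value is below \<open>E\<close>. The means are finite and
  cancel, leaving a lower bound that does not depend on n.\<close>

lemma prob_max_walk_less_ge: "1 - (\<integral>t. \<bar>t\<bar> \<partial>\<mu>) / E \<le> measure harvests {\<omega>. max_walk E n \<omega> < E}"
proof -
  let ?a = "\<lambda>n. \<integral>\<^sup>+\<omega>. ennreal (max_walk E n \<omega>) \<partial>harvests"
  let ?p = "measure harvests {\<omega>. max_walk E n \<omega> < E}" and ?m = "\<integral>t. \<bar>t\<bar> \<partial>\<mu>"
  have [measurable]: "{\<omega>. max_walk E n \<omega> < E} \<in> sets harvests"
  proof -
    have "{\<omega> \<in> space harvests. max_walk E n \<omega> < E} \<in> sets harvests" by measurable
    then show ?thesis by simp
  qed
  \<comment> \<open>For w \<ge> E the truncation at 0 is inactive; below \<open>E\<close> it gains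
    at most \<open>E\<close>.\<close>
  have le: "max 0 (w + t - E) + E \<le> t + (w + E * indicator {..<E} w)" if "0 \<le> w" "0 \<le> t" for w t
    using that E_pos by (auto simp: indicator_def max_def)
  have "?a n + ennreal E \<le> ?a (Suc n) + ennreal E"
    by (intro add_right_mono nn_integral_mono ennreal_leI max_walk_Suc_ge)
  also have "\<dots> = (\<integral>\<^sup>+t. \<integral>\<^sup>+\<omega>. ennreal (max_walk E (Suc n) (t ## \<omega>)) \<partial>harvests \<partial>\<mu>) + ennreal E"
    by (subst nn_integral_stream_space) simp_all
  also have "\<dots> = (\<integral>\<^sup>+t. \<integral>\<^sup>+\<omega>. ennreal (max 0 (max_walk E n \<omega> + \<bar>t\<bar> - E) + E) \<partial>harvests \<partial>\<mu>)"
    using emeasure_space_1 harvests.emeasure_space_1 E_pos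
    by (simp add: nn_integral_add ennreal_plus)
  also have "\<dots> \<le> (\<integral>\<^sup>+t. \<integral>\<^sup>+\<omega>. ennreal (\<bar>t\<bar> + (max_walk E n \<omega> + E * indicator {..<E} (max_walk E n \<omega>))) \<partial>harvests \<partial>\<mu>)"
    by (intro nn_integral_mono ennreal_leI le max_walk_nonneg) simp
  also have "\<dots> = (\<integral>\<^sup>+t. \<integral>\<^sup>+\<omega>. ennreal \<bar>t\<bar> + (ennreal (max_walk E n \<omega>) +
      ennreal E * indicator {\<omega>. max_walk E n \<omega> < E} \<omega>) \<partial>harvests \<partial>\<mu>)"
    using E_pos max_walk_nonneg[of E n]
    by (intro nn_integral_cong) (auto simp: ennreal_plus indicator_def)
  also have "\<dots> = (\<integral>\<^sup>+t. ennreal \<bar>t\<bar> \<partial>\<mu>) + (?a n + ennreal E * emeasure harvests {\<omega>. max_walk E n \<omega> < E})"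
    using emeasure_space_1 harvests.emeasure_space_1
    by (simp add: nn_integral_add nn_integral_cmult)
  also have "\<dots> = ?a n + ennreal (?m + E * ?p)"
    using integrable_mu E_pos
    by (simp add: nn_integral_eq_integral harvests.emeasure_eq_measure ennreal_plus ennreal_mult add_ac)
  finally have "ennreal E \<le> ennreal (?m + E * ?p)"
    using nn_integral_max_walk_finite[of n] by (auto simp: ennreal_add_left_cancel_le)
  then have "E \<le> ?m + E * ?p" using E_pos by (subst (asm) ennreal_le_iff) auto
  then show ?thesis using E_pos by (simp add: field_simps)
qed

text \<open>The events that the maximum is still below \<open>E\<close> decrease in n and keep a
  uniform positive probability. On their intersection the monotone sequence is bounded.\<close>

lemma emeasure_convergent_max_walk_pos: "0 < emeasure harvests {\<omega>. convergent (\<lambda>n. max_walk E n \<omega>)}"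
  and sets_convergent_max_walk: "{\<omega>. convergent (\<lambda>n. max_walk E n \<omega>)} \<in> sets harvests"
proof -
  define A where "A n = {\<omega> \<in> space harvests. max_walk E n \<omega> < E}" for n
  have A[measurable]: "A n \<in> sets harvests" for n unfolding A_def by measurable
  have "{\<omega> \<in> space harvests. Cauchy (\<lambda>n. max_walk E n \<omega>)} \<in> sets harvests" by measurable
  then show F: "{\<omega>. convergent (\<lambda>n. max_walk E n \<omega>)} \<in> sets harvests"
    by (simp add: Cauchy_convergent_iff)
  have "decseq A"
    unfolding A_def by (intro decseq_SucI) (auto intro: le_less_trans[OF max_walk_Suc_ge] simp del: max_walk.simps)
  then have "(\<lambda>n. measure harvests (A n)) \<longlonglongrightarrow> measure harvests (\<Inter>n. A n)"
    by (intro harvests.finite_Lim_measure_decseq) auto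
  then have "1 - (\<integral>t. \<bar>t\<bar> \<partial>\<mu>) / E \<le> measure harvests (\<Inter>n. A n)"
    by (rule LIMSEQ_le_const) (use prob_max_walk_less_ge in \<open>auto simp: A_def\<close>)
  moreover have "0 < 1 - (\<integral>t. \<bar>t\<bar> \<partial>\<mu>) / E" using mean_less E_pos by simp
  moreover have "measure harvests (\<Inter>n. A n) \<le> measure harvests {\<omega>. convergent (\<lambda>n. max_walk E n \<omega>)}"
  proof (rule harvests.finite_measure_mono[OF _ F], rule subsetI)
    fix \<omega> assume "\<omega> \<in> (\<Inter>n. A n)"
    then have "Bseq (\<lambda>n. max_walk E n \<omega>)"
      using max_walk_nonneg[of E _ \<omega>] by (intro BseqI'[where K = E]) (auto simp: A_def less_imp_le)
    then show "\<omega> \<in> {\<omega>. convergent (\<lambda>n. max_walk E n \<omega>)}"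
      by (auto intro!: Bseq_mono_convergent lift_Suc_mono_le max_walk_Suc_ge)
  qed
  ultimately show "0 < emeasure harvests {\<omega>. convergent (\<lambda>n. max_walk E n \<omega>)}"
    by (simp add: harvests.emeasure_eq_measure)
qed

text \<open>The Lindley recursion has a stationary law: the all-time supremum of the random walk,
  conditioned on being finite. (It is finite almost surely, but positive probability suffices.)\<close>

lemma Lindley_stationary_law:
  obtains \<alpha> :: "real measure" where "prob_space \<alpha>" "sets \<alpha> = sets borel" "AE w in \<alpha>. 0 \<le> w"
    "\<And>g. g \<in> borel_measurable borel \<Longrightarrow>
      (\<integral>\<^sup>+w. g w \<partial>\<alpha>) = (\<integral>\<^sup>+w. \<integral>\<^sup>+t. g (max 0 (w + \<bar>t\<bar> - E)) \<partial>\<mu> \<partial>\<alpha>)"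
proof
  define F where "F = {\<omega>. convergent (\<lambda>n. max_walk E n \<omega>)}"
  define W where "W \<omega> = lim (\<lambda>n. max_walk E n \<omega>)" for \<omega>
  define \<alpha> where "\<alpha> = distr (uniform_measure harvests F) borel W"
  have F[measurable]: "F \<in> sets harvests" and Fpos: "0 < emeasure harvests F"
    unfolding F_def by (fact sets_convergent_max_walk, fact emeasure_convergent_max_walk_pos)
  have W[measurable]: "W \<in> borel_measurable harvests"
    unfolding W_def by measurable
  interpret U: prob_space "uniform_measure harvests F"
    using Fpos by (intro prob_space_uniform_measure) (auto simp: harvests.emeasure_eq_measure)
  show "prob_space \<alpha>" unfolding \<alpha>_def by (rule U.prob_space_distr) simp
  interpret \<alpha>: prob_space \<alpha> by fact
  show "sets \<alpha> = sets borel" by (simp add: \<alpha>_def)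
  have int: "(\<integral>\<^sup>+w. g w \<partial>\<alpha>) = (\<integral>\<^sup>+\<omega>. g (W \<omega>) * indicator F \<omega> \<partial>harvests) / emeasure harvests F"
    if [measurable]: "g \<in> borel_measurable borel" for g
    unfolding \<alpha>_def by (subst nn_integral_distr) (simp_all add: nn_integral_uniform_measure)
  have "0 \<le> W \<omega>" if "\<omega> \<in> F" for \<omega>
    using that max_walk_nonneg[of E _ \<omega>] unfolding F_def W_def
    by (auto simp: convergent_LIMSEQ_iff intro: LIMSEQ_le_const)
  then have "AE \<omega> in uniform_measure harvests F. 0 \<le> W \<omega>"
    by (intro AE_uniform_measureI) auto
  then show "AE w in \<alpha>. 0 \<le> w" unfolding \<alpha>_def by (subst AE_distr_iff) auto
  fix g :: "real \<Rightarrow> ennreal" assume g[measurable]: "g \<in> borel_measurable borel"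
  interpret P: pair_sigma_finite \<mu> harvests ..
  have [measurable]: "(\<lambda>w. \<integral>\<^sup>+t. g (max 0 (w + \<bar>t\<bar> - E)) \<partial>\<mu>) \<in> borel_measurable borel" by measurable
  have "(\<integral>\<^sup>+\<omega>. g (W \<omega>) * indicator F \<omega> \<partial>harvests) =
      (\<integral>\<^sup>+t. \<integral>\<^sup>+\<omega>. g (W (t ## \<omega>)) * indicator F (t ## \<omega>) \<partial>harvests \<partial>\<mu>)"
    by (rule nn_integral_stream_space) measurable
  \<comment> \<open>\<open>F\<close> holds for \<open>t ## \<omega>\<close> exactly when it holds
    for \<open>\<omega>\<close>, so its indicator passes through the shift while \<open>W\<close>
    obeys the recursion.\<close>
  also have "\<dots> = (\<integral>\<^sup>+t. \<integral>\<^sup>+\<omega>. g (max 0 (W \<omega> + \<bar>t\<bar> - E)) * indicator F \<omega> \<partial>harvests \<partial>\<mu>)"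
    by (intro nn_integral_cong)
      (use convergent_max_walk_stl[of E "_ ## _"] lim_max_walk_stl[of E "_ ## _"] in
        \<open>auto simp: F_def W_def indicator_def\<close>)
  also have "\<dots> = (\<integral>\<^sup>+\<omega>. \<integral>\<^sup>+t. g (max 0 (W \<omega> + \<bar>t\<bar> - E)) * indicator F \<omega> \<partial>\<mu> \<partial>harvests)"
    by (rule P.Fubini'[symmetric]) measurable
  also have "\<dots> = (\<integral>\<^sup>+\<omega>. (\<integral>\<^sup>+t. g (max 0 (W \<omega> + \<bar>t\<bar> - E)) \<partial>\<mu>) * indicator F \<omega> \<partial>harvests)"
    by (simp add: nn_integral_multc)
  finally show "(\<integral>\<^sup>+w. g w \<partial>\<alpha>) = (\<integral>\<^sup>+w. \<integral>\<^sup>+t. g (max 0 (w + \<bar>t\<bar> - E)) \<partial>\<mu> \<partial>\<alpha>)"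
    by (simp add: int)
qed

text \<open>For \<open>z < E\<close>, consumption rotates the level \<open>z + v\<close> on the circle of length \<open>E\<close>, which
  preserves the uniform law of \<open>v\<close>; for \<open>z \<ge> E\<close> it always takes place.\<close>

lemma nn_integral_uniform_consume:
  fixes f :: "real \<Rightarrow> ennreal"
  assumes f[measurable]: "f \<in> borel_measurable borel" and z: "0 \<le> z"
  shows "(\<integral>\<^sup>+v. f (z + v - indicator {E<..} (z + v) * E) * indicator {0..E} v \<partial>lborel) =
    (\<integral>\<^sup>+v. f (max 0 (z - E) + v) * indicator {0..E} v \<partial>lborel)"
proof (cases "E \<le> z")
  case True
  \<comment> \<open>Consumption requires a level strictly above \<open>E\<close>, so z = E with v =
    0 is an exception, of Lebesgue measure 0 in v.\<close>
  show ?thesis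
    using AE_lborel_singleton[of 0]
    by (intro nn_integral_cong_AE, eventually_elim) (use True in \<open>auto simp: indicator_def algebra_simps\<close>)
next
  case False
  \<comment> \<open>Up to v = E - z nothing is consumed and the levels fill [z, E]; the remaining v
    fill (0, z] after consumption.\<close>
  have "(\<integral>\<^sup>+v. f (z + v - indicator {E<..} (z + v) * E) * indicator {0..E} v \<partial>lborel) =
      (\<integral>\<^sup>+v. f (z + v) * indicator {0..E-z} v + f (z + v - E) * indicator {E-z<..E} v \<partial>lborel)"
    using False z by (intro nn_integral_cong) (auto simp: indicator_def)
  also have "\<dots> = (\<integral>\<^sup>+v. f (z + v) * indicator {0..E-z} v \<partial>lborel) +
      (\<integral>\<^sup>+v. f (z + v - E) * indicator {E-z<..E} v \<partial>lborel)"
    by (rule nn_integral_add) measurable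
  also have "(\<integral>\<^sup>+v. f (z + v) * indicator {0..E-z} v \<partial>lborel) = (\<integral>\<^sup>+v. f v * indicator {z..E} v \<partial>lborel)"
    by (subst (2) nn_integral_real_affine[where c = 1 and t = z])
      (auto intro!: nn_integral_cong simp: indicator_def)
  also have "(\<integral>\<^sup>+v. f (z + v - E) * indicator {E-z<..E} v \<partial>lborel) = (\<integral>\<^sup>+v. f v * indicator {0<..z} v \<partial>lborel)"
    by (subst (2) nn_integral_real_affine[where c = 1 and t = "z - E"])
      (auto intro!: nn_integral_cong simp: indicator_def algebra_simps)
  also have "(\<integral>\<^sup>+v. f v * indicator {z..E} v \<partial>lborel) + (\<integral>\<^sup>+v. f v * indicator {0<..z} v \<partial>lborel) =
      (\<integral>\<^sup>+v. f v * indicator {z..E} v + f v * indicator {0<..z} v \<partial>lborel)"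
    by (rule nn_integral_add[symmetric]) measurable
  also have "\<dots> = (\<integral>\<^sup>+v. f (max 0 (z - E) + v) * indicator {0..E} v \<partial>lborel)"
    using AE_lborel_singleton[of 0] AE_lborel_singleton[of z]
    by (intro nn_integral_cong_AE, eventually_elim) (use False z in \<open>auto simp: indicator_def\<close>)
  finally show ?thesis .
qed

text \<open>Consumption turns W + H + V into (W + H - E)^+ + V in law. By stationarity of W this is
  W + V in law, and the next harvest adds a fresh independent H.\<close>

lemma invariant_probability_exists: "\<exists>\<pi>. invariant_probability battery_space chain_kernel \<pi>"
proof -
  obtain \<alpha> :: "real measure" where "prob_space \<alpha>" and sets_\<alpha>[measurable_cong]: "sets \<alpha> = sets borel"
    and \<alpha>_nonneg: "AE w in \<alpha>. 0 \<le> w"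
    and Lindley: "\<And>g. g \<in> borel_measurable borel \<Longrightarrow>
      (\<integral>\<^sup>+w. g w \<partial>\<alpha>) = (\<integral>\<^sup>+w. \<integral>\<^sup>+t. g (max 0 (w + \<bar>t\<bar> - E)) \<partial>\<mu> \<partial>\<alpha>)"
    using Lindley_stationary_law by metis
  interpret \<alpha>: prob_space \<alpha> by fact
  define U where "U = uniform_measure lborel {0..E}"
  have sets_U[measurable_cong]: "sets U = sets borel" by (simp add: U_def)
  interpret U: prob_space U
    unfolding U_def using E_pos by (intro prob_space_uniform_measure) auto
  have U_nonneg: "AE v in U. 0 \<le> v" unfolding U_def by (intro AE_uniform_measureI) auto
  have U_int: "(\<integral>\<^sup>+v. f (z + v - indicator {E<..} (z + v) * E) \<partial>U) = (\<integral>\<^sup>+v. f (max 0 (z - E) + v) \<partial>U)"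
    if [measurable]: "f \<in> borel_measurable borel" and "0 \<le> z" for f :: "real \<Rightarrow> ennreal" and z
    unfolding U_def using nn_integral_uniform_consume[OF that]
    by (subst (1 2) nn_integral_uniform_measure) simp_all
  interpret UM: pair_sigma_finite U \<mu> ..
  interpret \<mu>U: pair_prob_space \<mu> U ..
  interpret P: pair_prob_space \<alpha> "\<mu> \<Otimes>\<^sub>M U" ..
  \<comment> \<open>The absolute values on w and v force a value in [0, \<infinity>) everywhere and
    are almost surely inactive; the one on t is part of the harvest.\<close>
  define X where "X = (\<lambda>(w, t, v). \<bar>w\<bar> + \<bar>t\<bar> + \<bar>v\<bar> :: real)"
  define \<pi> where "\<pi> = distr (\<alpha> \<Otimes>\<^sub>M (\<mu> \<Otimes>\<^sub>M U)) battery_space X"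
  have X: "X \<in> \<alpha> \<Otimes>\<^sub>M (\<mu> \<Otimes>\<^sub>M U) \<rightarrow>\<^sub>M battery_space"
    unfolding X_def by (rule measurable_battery_spaceI) auto
  have prob: "prob_space \<pi>" unfolding \<pi>_def by (rule P.prob_space_distr[OF X])
  have int_\<pi>: "(\<integral>\<^sup>+x. g x \<partial>\<pi>) = (\<integral>\<^sup>+w. \<integral>\<^sup>+t. \<integral>\<^sup>+v. g (w + \<bar>t\<bar> + v) \<partial>U \<partial>\<mu> \<partial>\<alpha>)"
    if [measurable]: "g \<in> borel_measurable borel" for g :: "real \<Rightarrow> ennreal"
  proof -
    have "(\<integral>\<^sup>+x. g x \<partial>\<pi>) = (\<integral>\<^sup>+p. g (X p) \<partial>(\<alpha> \<Otimes>\<^sub>M (\<mu> \<Otimes>\<^sub>M U)))"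
      unfolding \<pi>_def by (subst nn_integral_distr[OF X]) (auto intro: measurable_from_battery_space)
    also have "\<dots> = (\<integral>\<^sup>+w. \<integral>\<^sup>+q. g (X (w, q)) \<partial>(\<mu> \<Otimes>\<^sub>M U) \<partial>\<alpha>)"
      by (rule \<mu>U.nn_integral_fst[symmetric]) (unfold X_def, measurable)
    also have "\<dots> = (\<integral>\<^sup>+w. \<integral>\<^sup>+t. \<integral>\<^sup>+v. g (X (w, t, v)) \<partial>U \<partial>\<mu> \<partial>\<alpha>)"
      by (intro nn_integral_cong U.nn_integral_fst[symmetric]) (unfold X_def, measurable)
    also have "\<dots> = (\<integral>\<^sup>+w. \<integral>\<^sup>+t. \<integral>\<^sup>+v. g (w + \<bar>t\<bar> + v) \<partial>U \<partial>\<mu> \<partial>\<alpha>)"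
    proof (rule nn_integral_cong_AE, use \<alpha>_nonneg in eventually_elim, rule nn_integral_cong)
      fix w t :: real assume w: "0 \<le> w"
      show "(\<integral>\<^sup>+v. g (X (w, t, v)) \<partial>U) = (\<integral>\<^sup>+v. g (w + \<bar>t\<bar> + v) \<partial>U)"
        by (rule nn_integral_cong_AE, use U_nonneg in eventually_elim) (simp add: X_def w)
    qed
    finally show ?thesis .
  qed
  have "emeasure \<pi> A = (\<integral>\<^sup>+x. emeasure (chain_kernel x) A \<partial>\<pi>)" if A: "A \<in> sets battery_space" for A
  proof -
    have A'[measurable]: "A \<in> sets borel" using A by (simp add: sets_battery_space)
    \<comment> \<open>The kernel consumes and then harvests. Here \<open>g\<close> is the harvesting
      half, so the kernel is \<open>g\<close> evaluated at the level left by consumption.\<close>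
    define g where "g y = (\<integral>\<^sup>+t. indicator A (y + \<bar>t\<bar>) \<partial>\<mu>)" for y :: real
    have g[measurable]: "g \<in> borel_measurable borel" unfolding g_def by measurable
    have [measurable]: "(\<lambda>y. \<integral>\<^sup>+v. g (y + v) \<partial>U) \<in> borel_measurable borel" by measurable
    have "(\<integral>\<^sup>+x. emeasure (chain_kernel x) A \<partial>\<pi>) = (\<integral>\<^sup>+x. g (x - indicator {E<..} x * E) \<partial>\<pi>)"
    proof (rule nn_integral_cong)
      fix x assume "x \<in> space \<pi>"
      then have x: "0 \<le> x" by (simp add: \<pi>_def)
      have "emeasure (chain_kernel x) A = (\<integral>\<^sup>+y. indicator A y \<partial>chain_kernel x)"
        using A by (simp add: kernel_eq)
      also have "\<dots> = (\<integral>\<^sup>+t. indicator A (battery_step E x t) \<partial>\<mu>)"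
        by (rule nn_integral_kernel[OF x]) (use A in simp)
      finally show "emeasure (chain_kernel x) A = g (x - indicator {E<..} x * E)"
        by (simp add: g_def battery_step_def algebra_simps)
    qed
    also have "\<dots> = (\<integral>\<^sup>+w. \<integral>\<^sup>+t. \<integral>\<^sup>+v. g (w + \<bar>t\<bar> + v - indicator {E<..} (w + \<bar>t\<bar> + v) * E) \<partial>U \<partial>\<mu> \<partial>\<alpha>)"
      by (rule int_\<pi>) measurable
    also have "\<dots> = (\<integral>\<^sup>+w. \<integral>\<^sup>+t. \<integral>\<^sup>+v. g (max 0 (w + \<bar>t\<bar> - E) + v) \<partial>U \<partial>\<mu> \<partial>\<alpha>)"
      by (rule nn_integral_cong_AE, use \<alpha>_nonneg in eventually_elim, rule nn_integral_cong, rule U_int) auto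
    also have "\<dots> = (\<integral>\<^sup>+w. \<integral>\<^sup>+v. g (w + v) \<partial>U \<partial>\<alpha>)"
      by (rule Lindley[symmetric]) measurable
    also have "\<dots> = (\<integral>\<^sup>+w. \<integral>\<^sup>+t. \<integral>\<^sup>+v. indicator A (w + v + \<bar>t\<bar>) \<partial>U \<partial>\<mu> \<partial>\<alpha>)"
      unfolding g_def by (intro nn_integral_cong UM.Fubini'[symmetric]) measurable
    also have "\<dots> = (\<integral>\<^sup>+x. indicator A x \<partial>\<pi>)"
      by (subst int_\<pi>) (simp_all add: add_ac)
    finally show ?thesis using A by (simp add: \<pi>_def)
  qed
  then show ?thesis
    unfolding invariant_probability_def using prob by (intro exI[of _ \<pi>]) (simp add: \<pi>_def)
qed

section \<open>Harris recurrence and uniqueness\<close>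

definition reduce :: "real \<Rightarrow> real" where
  "reduce u = u - of_int \<lfloor>u / E\<rfloor> * E"

lemma reduce_bounds: "0 \<le> reduce u" "reduce u < E"
  unfolding reduce_def using floor_shift_bounds[OF E_pos] by auto

lemma reduce_periodic: "reduce (u + E) = reduce u"
  unfolding reduce_def using E_pos by (simp add: add_divide_distrib algebra_simps)

lemma measurable_reduce[measurable]: "reduce \<in> borel_measurable borel"
  unfolding reduce_def[abs_def] by measurable

lemma reduce_decompose: "0 \<le> u \<Longrightarrow> \<exists>m. u = reduce u + real m * E"
  using E_pos by (intro exI[of _ "nat \<lfloor>u / E\<rfloor>"]) (simp add: reduce_def)

lemma harmonic_constant:
  fixes h :: "real \<Rightarrow> real"
  assumes h[measurable]: "h \<in> borel_measurable borel" and bound: "\<And>x. \<bar>h x\<bar> \<le> C"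
    and harm: "\<And>x. 0 \<le> x \<Longrightarrow> h x = (\<integral>t. h (battery_step E x t) \<partial>\<mu>)"
    and xy: "0 \<le> x" "0 \<le> y"
  shows "h x = h y"
proof -
  \<comment> \<open>Applied to a constant sequence, the merging lemma has a constant difference
    tending to 0, which is therefore 0.\<close>
  have hr: "h (reduce u) = h u" if "0 \<le> u" for u
  proof -
    from reduce_decompose[OF that] obtain m where "u = reduce u + real m * E" by blast
    with fibre_differences_tendsto_0[of "\<lambda>_. h" C "reduce u" m] assms reduce_bounds(1)[of u]
    show ?thesis by (simp add: LIMSEQ_const_iff)
  qed
  have "h (reduce x) = h (reduce y)"
  proof (rule harmonic_periodic_constant[where k = "\<lambda>u. h (reduce u)" and C = C])
    show "(\<lambda>u. h (reduce u)) \<in> borel_measurable borel" by measurable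
    fix u
    \<comment> \<open>The representative lies below \<open>E\<close>, where nothing is consumed; so
      one step of the chain from it is exactly one step of the circle walk, up to multiples of
      \<open>E\<close>, which \<open>h\<close> does not see.\<close>
    have "h (reduce (u + \<bar>t\<bar>)) = h (battery_step E (reduce u) t)" for t
    proof -
      have "reduce (u + \<bar>t\<bar>) = reduce (reduce u + \<bar>t\<bar>)"
        using periodic_int_multiple[of reduce E "u + \<bar>t\<bar>" "- \<lfloor>u / E\<rfloor>"] reduce_periodic
        by (simp add: reduce_def[of u] algebra_simps)
      then show ?thesis using hr[of "reduce u + \<bar>t\<bar>"] reduce_bounds[of u] by (simp add: battery_step_def)
    qed
    then show "h (reduce u) = (\<integral>t. h (reduce (u + \<bar>t\<bar>)) \<partial>\<mu>)" using harm[OF reduce_bounds(1)] by simp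
  qed (simp_all add: bound reduce_periodic)
  then show ?thesis using hr xy by simp
qed

section \<open>The zero-one law for infinitely many visits\<close>

definition io_event :: "real set \<Rightarrow> real \<Rightarrow> real stream set" where
  "io_event A x = {\<omega>. \<exists>\<^sub>\<infinity>n. battery_path E x n \<omega> \<in> A}"

lemma pred_path_pair:
  assumes A: "A \<in> sets borel"
  shows "Measurable.pred (borel \<Otimes>\<^sub>M harvests) (\<lambda>p. battery_path E (fst p) n (snd p) \<in> A)"
  by (rule pred_sets2[OF A]) measurable

lemma pred_io_pair:
  assumes A: "A \<in> sets borel"
  shows "Measurable.pred (borel \<Otimes>\<^sub>M harvests) (\<lambda>p. snd p \<in> io_event A (fst p))"
proof -
  note [measurable] = pred_path_pair[OF A]
  show ?thesis unfolding io_event_def mem_Collect_eq INFM_nat_le by measurable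
qed

lemma sets_io_event:
  assumes A: "A \<in> sets borel"
  shows "io_event A x \<in> sets harvests"
proof -
  have "Measurable.pred harvests (\<lambda>\<omega>. snd (x, \<omega>) \<in> io_event A (fst (x, \<omega>)))"
    by (rule measurable_compose[OF _ pred_io_pair[OF A]]) simp
  then show ?thesis by (simp add: pred_def)
qed

lemma io_event_stream: "t ## \<omega> \<in> io_event A x \<longleftrightarrow> \<omega> \<in> io_event A (battery_step E x t)"
proof -
  have "(\<exists>\<^sub>\<infinity>n. P n) \<longleftrightarrow> (\<exists>\<^sub>\<infinity>n. P (Suc n))" for P :: "nat \<Rightarrow> bool"
    using MOST_Suc_iff[of "\<lambda>n. \<not> P n"] by (simp only: frequently_def)
  from this[of "\<lambda>n. battery_path E x n (t ## \<omega>) \<in> A"] show ?thesis by (simp add: io_event_def)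
qed

lemma measurable_prob_section:
  assumes "Measurable.pred (borel \<Otimes>\<^sub>M harvests) (\<lambda>p. P (fst p) (snd p))"
  shows "(\<lambda>x. measure harvests {\<omega>. P x \<omega>}) \<in> borel_measurable borel"
proof -
  have "(\<lambda>x. emeasure harvests (Pair x -` {p \<in> space (borel \<Otimes>\<^sub>M harvests). P (fst p) (snd p)})) \<in> borel_measurable borel"
    using assms by (intro harvests.measurable_emeasure_Pair) (simp add: pred_def)
  then show ?thesis by (simp add: measure_def space_pair_measure vimage_def)
qed

text \<open>First-step analysis in real-valued form. The section \<open>G\<close> is a separate
  variable tied to \<open>F\<close> by an equation, so that it can be instantiated in already
  simplified form.\<close>

lemma measure_stream_event:
  assumes "F \<in> sets harvests" and "\<And>t. G t = {\<omega>. t ## \<omega> \<in> F}"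
  shows "measure harvests F = (\<integral>t. measure harvests (G t) \<partial>\<mu>)"
proof -
  have *: "(\<lambda>t. emeasure harvests {\<omega>. t ## \<omega> \<in> F}) \<in> borel_measurable \<mu>"
  proof -
    have "{p \<in> space (\<mu> \<Otimes>\<^sub>M harvests). fst p ## snd p \<in> F} \<in> sets (\<mu> \<Otimes>\<^sub>M harvests)"
      using assms(1) by measurable
    from harvests.measurable_emeasure_Pair[OF this] show ?thesis
      by (simp add: space_pair_measure vimage_def)
  qed
  then have m: "(\<lambda>t. measure harvests {\<omega>. t ## \<omega> \<in> F}) \<in> borel_measurable \<mu>"
    unfolding measure_def by measurable
  have "ennreal (measure harvests F) = emeasure harvests F"
    by (simp add: harvests.emeasure_eq_measure)
  also have "\<dots> = (\<integral>\<^sup>+t. emeasure harvests {\<omega>. t ## \<omega> \<in> F} \<partial>\<mu>)"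
    by (subst emeasure_stream_space[OF assms(1)]) simp
  also have "\<dots> = (\<integral>\<^sup>+t. ennreal (measure harvests {\<omega>. t ## \<omega> \<in> F}) \<partial>\<mu>)"
    by (simp add: harvests.emeasure_eq_measure)
  also have "\<dots> = ennreal (\<integral>t. measure harvests {\<omega>. t ## \<omega> \<in> F} \<partial>\<mu>)"
    using m by (intro nn_integral_eq_integral integrable_const_bound[where B = 1]) auto
  finally show ?thesis
    unfolding assms(2) by (subst (asm) ennreal_inj) (auto intro: integral_nonneg_AE)
qed

lemma prob_io_constant:
  assumes A: "A \<in> sets borel" and xy: "0 \<le> x" "0 \<le> y"
  shows "measure harvests (io_event A x) = measure harvests (io_event A y)"
proof (rule harmonic_constant[OF _ _ _ xy])
  show "(\<lambda>x. measure harvests (io_event A x)) \<in> borel_measurable borel"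
    using measurable_prob_section[OF pred_io_pair[OF A]] by simp
  show "\<bar>measure harvests (io_event A x)\<bar> \<le> 1" for x by simp
  show "measure harvests (io_event A x) = (\<integral>t. measure harvests (io_event A (battery_step E x t)) \<partial>\<mu>)" for x
    by (rule measure_stream_event[OF sets_io_event[OF A]]) (auto simp: io_event_stream)
qed

text \<open>The conditional probability of infinitely many visits, given finitely many harvests, is the
  same constant; so the event is independent of itself.\<close>

lemma prob_io_zero_one:
  assumes A: "A \<in> sets borel" and x: "0 \<le> x" and pos: "0 < measure harvests (io_event A x)"
  shows "measure harvests (io_event A x) = 1"
proof -
  define c where "c = measure harvests (io_event A x)"
  have c: "measure harvests (io_event A y) = c" if "0 \<le> y" for y
    unfolding c_def using prob_io_constant[OF A that x] .
  let ?S = "scylinder UNIV"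
  have sets_cyl: "?S Fs \<in> sets harvests" if "Fs \<in> lists (sets \<mu>)" for Fs
    using sets_scylinder[of Fs \<mu>] that by (auto simp: in_lists_conv_set)
  \<comment> \<open>The starting point has to vary: each prescribed harvest moves it, and the
    constant \<open>c\<close> is the same for all of them.\<close>
  have cyl: "measure harvests (io_event A y \<inter> ?S Fs) = c * measure harvests (?S Fs)"
    if "0 \<le> y" "Fs \<in> lists (sets \<mu>)" for y Fs
    using that(2,1)
  proof (induction Fs arbitrary: y)
    case Nil
    then show ?case using c[of y] harvests.prob_space by simp
  next
    case (Cons F Fs)
    have cyl_sets: "?S (F # Fs) \<in> sets harvests" using Cons.hyps by (intro sets_cyl) auto
    have "measure harvests (io_event A y \<inter> ?S (F # Fs)) =
        (\<integral>t. measure harvests (if t \<in> F then io_event A (battery_step E y t) \<inter> ?S Fs else {}) \<partial>\<mu>)"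
      by (rule measure_stream_event[OF sets.Int[OF sets_io_event[OF A] cyl_sets]]) (auto simp: io_event_stream)
    also have "\<dots> = (\<integral>t. c * measure harvests (if t \<in> F then ?S Fs else {}) \<partial>\<mu>)"
    proof (rule Bochner_Integration.integral_cong[OF refl])
      fix t
      show "measure harvests (if t \<in> F then io_event A (battery_step E y t) \<inter> ?S Fs else {}) =
          c * measure harvests (if t \<in> F then ?S Fs else {})"
        using Cons.IH[OF battery_step_nonneg[OF E_pos Cons.prems]] by (cases "t \<in> F") simp_all
    qed
    also have "\<dots> = c * (\<integral>t. measure harvests (if t \<in> F then ?S Fs else {}) \<partial>\<mu>)"
      by (rule integral_mult_right_zero)
    also have "(\<integral>t. measure harvests (if t \<in> F then ?S Fs else {}) \<partial>\<mu>) = measure harvests (?S (F # Fs))"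
      by (rule measure_stream_event[OF cyl_sets, symmetric]) auto
    finally show ?case .
  qed
  \<comment> \<open>By \<open>cyl\<close>, conditioning on the event does not change the probability
    of any cylinder, hence not the law of the stream. Evaluating both laws on the event itself gives
    probability 1.\<close>
  let ?U = "uniform_measure harvests (io_event A x)"
  have "?U = harvests"
  proof (rule stream_space_eq_scylinder[of _ _ "sets \<mu>" \<mu> "{UNIV}"])
    show "prob_space ?U"
      using pos by (intro prob_space_uniform_measure) (auto simp: harvests.emeasure_eq_measure)
    show "sets \<mu> = sets (sigma (space \<mu>) (sets \<mu>))"
      by (metis sets.sigma_sets_eq sets.space_closed sets_measure_of)
    fix Fs assume Fs: "Fs \<in> lists (sets \<mu>)"
    have "emeasure ?U (?S Fs) = ennreal (measure harvests (io_event A x \<inter> ?S Fs) / measure harvests (io_event A x))"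
      using sets_io_event[OF A, of x] sets_cyl[OF Fs] pos
      by (simp add: harvests.emeasure_eq_measure divide_ennreal)
    also have "\<dots> = emeasure harvests (?S Fs)"
      unfolding cyl[OF x Fs] using pos by (simp add: harvests.emeasure_eq_measure c_def)
    finally show "emeasure ?U (scylinder (space \<mu>) Fs) = emeasure harvests (scylinder (space \<mu>) Fs)" by simp
  qed (auto simp: sets.Int_stable harvests.prob_space_axioms sets.sets_into_space)
  then have "emeasure ?U (io_event A x) = emeasure harvests (io_event A x)" by simp
  moreover have "emeasure ?U (io_event A x) = 1"
    using pos sets_io_event[OF A, of x] by (intro emeasure_uniform_measure_1) (auto simp: harvests.emeasure_eq_measure)
  ultimately show ?thesis by (simp add: harvests.emeasure_eq_measure)
qed

section \<open>Visit probabilities under stationary laws\<close>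

definition visit_prob :: "real set \<Rightarrow> nat \<Rightarrow> real \<Rightarrow> real" where
  "visit_prob A n x = measure harvests {\<omega>. battery_path E x n \<omega> \<in> A}"

lemma visit_prob_bounds: "0 \<le> visit_prob A n x" "visit_prob A n x \<le> 1"
  by (simp_all add: visit_prob_def)

lemma visit_prob_0: "visit_prob A 0 x = indicator A x"
  using harvests.prob_space by (simp add: visit_prob_def indicator_def)

lemma measurable_visit_prob: "A \<in> sets borel \<Longrightarrow> visit_prob A n \<in> borel_measurable borel"
  unfolding visit_prob_def[abs_def] by (rule measurable_prob_section[OF pred_path_pair])

lemma sets_visit: "A \<in> sets borel \<Longrightarrow> {\<omega>. battery_path E x n \<omega> \<in> A} \<in> sets harvests"
  using pred_path[of A x n] by (simp add: pred_def)

lemma visit_prob_Suc: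
  "A \<in> sets borel \<Longrightarrow> visit_prob A (Suc n) x = (\<integral>t. visit_prob A n (battery_step E x t) \<partial>\<mu>)"
  unfolding visit_prob_def by (rule measure_stream_event[OF sets_visit]) auto

text \<open>An invariant probability measure, pushed forward to the real line, where all test
  functions are Borel.\<close>

definition stationary_law :: "real measure \<Rightarrow> bool" where
  "stationary_law \<rho> \<longleftrightarrow> prob_space \<rho> \<and> sets \<rho> = sets borel \<and> (AE x in \<rho>. 0 \<le> x) \<and>
     (\<forall>(g :: real \<Rightarrow> real) C. g \<in> borel_measurable borel \<longrightarrow> (\<forall>x. \<bar>g x\<bar> \<le> C) \<longrightarrow>
        (\<integral>x. g x \<partial>\<rho>) = (\<integral>x. \<integral>t. g (battery_step E x t) \<partial>\<mu> \<partial>\<rho>))"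

lemma measurable_battery_space_ident: "(\<lambda>x. x) \<in> battery_space \<rightarrow>\<^sub>M borel"
  by (rule measurable_from_battery_space) simp

text \<open>Invariance as an identity of image measures lets Bochner integrals be transferred by
  change of variables.\<close>

lemma invariant_distr:
  assumes inv: "invariant_probability battery_space chain_kernel \<pi>"
  shows "distr (\<pi> \<Otimes>\<^sub>M \<mu>) battery_space (\<lambda>p. battery_step E (fst p) (snd p)) = \<pi>"
    and "(\<lambda>p. battery_step E (fst p) (snd p)) \<in> \<pi> \<Otimes>\<^sub>M \<mu> \<rightarrow>\<^sub>M battery_space"
proof -
  have "prob_space \<pi>" and sets_\<pi>[measurable_cong]: "sets \<pi> = sets battery_space"
    using inv by (simp_all add: invariant_probability_def)
  interpret \<pi>: prob_space \<pi> by fact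
  have space_\<pi>: "space \<pi> = {0..}" using sets_eq_imp_space_eq[OF sets_\<pi>] by simp
  have [measurable]: "(\<lambda>x. x) \<in> \<pi> \<rightarrow>\<^sub>M borel"
    using measurable_battery_space_ident by (simp only: measurable_cong_sets[OF sets_\<pi> refl])
  have "(\<lambda>p. battery_step E (fst p) (snd p)) \<in> borel_measurable (\<pi> \<Otimes>\<^sub>M \<mu>)" by measurable
  then show m: "(\<lambda>p. battery_step E (fst p) (snd p)) \<in> \<pi> \<Otimes>\<^sub>M \<mu> \<rightarrow>\<^sub>M battery_space"
    by (rule measurable_battery_spaceI) (auto simp: space_pair_measure space_\<pi> intro: battery_step_nonneg[OF E_pos])
  show "distr (\<pi> \<Otimes>\<^sub>M \<mu>) battery_space (\<lambda>p. battery_step E (fst p) (snd p)) = \<pi>"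
  proof (rule measure_eqI)
    fix A assume "A \<in> sets (distr (\<pi> \<Otimes>\<^sub>M \<mu>) battery_space (\<lambda>p. battery_step E (fst p) (snd p)))"
    then have A: "A \<in> sets battery_space" by simp
    have "emeasure (distr (\<pi> \<Otimes>\<^sub>M \<mu>) battery_space (\<lambda>p. battery_step E (fst p) (snd p))) A =
        (\<integral>\<^sup>+p. indicator A (battery_step E (fst p) (snd p)) \<partial>(\<pi> \<Otimes>\<^sub>M \<mu>))"
      using A by (subst nn_integral_indicator[symmetric], simp) (subst nn_integral_distr[OF m], simp_all)
    also have "\<dots> = (\<integral>\<^sup>+x. \<integral>\<^sup>+t. indicator A (battery_step E x t) \<partial>\<mu> \<partial>\<pi>)"
      using A by (subst nn_integral_fst[symmetric]) (auto intro: measurable_compose[OF m])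
    also have "\<dots> = (\<integral>\<^sup>+x. emeasure (chain_kernel x) A \<partial>\<pi>)"
    proof (rule nn_integral_cong)
      fix x assume "x \<in> space \<pi>"
      then show "(\<integral>\<^sup>+t. indicator A (battery_step E x t) \<partial>\<mu>) = emeasure (chain_kernel x) A"
        using A nn_integral_kernel[of x "indicator A"] by (simp add: space_\<pi> kernel_eq)
    qed
    also have "\<dots> = emeasure \<pi> A" using inv A by (simp add: invariant_probability_def)
    finally show "emeasure (distr (\<pi> \<Otimes>\<^sub>M \<mu>) battery_space (\<lambda>p. battery_step E (fst p) (snd p))) A = emeasure \<pi> A" .
  qed (simp add: sets_\<pi>)
qed

lemma invariant_imp_stationary:
  assumes inv: "invariant_probability battery_space chain_kernel \<pi>"
  shows "stationary_law (distr \<pi> borel (\<lambda>x. x))"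
    and "\<And>A. A \<in> sets battery_space \<Longrightarrow> emeasure (distr \<pi> borel (\<lambda>x. x)) A = emeasure \<pi> A"
proof -
  have "prob_space \<pi>" and sets_\<pi>[measurable_cong]: "sets \<pi> = sets battery_space"
    using inv by (simp_all add: invariant_probability_def)
  interpret \<pi>: prob_space \<pi> by fact
  interpret P: pair_prob_space \<pi> \<mu> ..
  have space_\<pi>: "space \<pi> = {0..}" using sets_eq_imp_space_eq[OF sets_\<pi>] by simp
  have id[measurable]: "(\<lambda>x. x) \<in> \<pi> \<rightarrow>\<^sub>M borel"
    using measurable_battery_space_ident by (simp only: measurable_cong_sets[OF sets_\<pi> refl])
  show "emeasure (distr \<pi> borel (\<lambda>x. x)) A = emeasure \<pi> A" if "A \<in> sets battery_space" for A
    using that by (subst emeasure_distr) (auto simp: sets_battery_space space_\<pi> intro!: arg_cong[where f = "emeasure \<pi>"])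
  have "AE x in \<pi>. 0 \<le> x" by (rule AE_I2) (simp add: space_\<pi>)
  moreover have "(\<integral>x. g x \<partial>\<pi>) = (\<integral>x. \<integral>t. g (battery_step E x t) \<partial>\<mu> \<partial>\<pi>)"
    if g[measurable]: "g \<in> borel_measurable borel" and C: "\<And>x. \<bar>g x\<bar> \<le> C" for g :: "real \<Rightarrow> real" and C
  proof -
    have "(\<integral>x. g x \<partial>\<pi>) = (\<integral>x. g x \<partial>distr (\<pi> \<Otimes>\<^sub>M \<mu>) battery_space (\<lambda>p. battery_step E (fst p) (snd p)))"
      by (simp only: invariant_distr(1)[OF inv])
    also have "\<dots> = (\<integral>p. g (battery_step E (fst p) (snd p)) \<partial>(\<pi> \<Otimes>\<^sub>M \<mu>))"
      by (rule integral_distr[OF invariant_distr(2)[OF inv] measurable_from_battery_space[OF g]])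
    also have "\<dots> = (\<integral>x. \<integral>t. g (battery_step E x t) \<partial>\<mu> \<partial>\<pi>)"
      by (subst P.integral_fst'[symmetric]) (auto intro!: P.integrable_const_bound[where B = C] simp: C)
    finally show ?thesis .
  qed
  ultimately show "stationary_law (distr \<pi> borel (\<lambda>x. x))"
    unfolding stationary_law_def
    by (auto simp: AE_distr_iff integral_distr intro!: \<pi>.prob_space_distr)
qed

lemma stationary_visit_prob:
  assumes \<rho>: "stationary_law \<rho>" and A: "A \<in> sets borel"
  shows "(\<integral>x. visit_prob A n x \<partial>\<rho>) = measure \<rho> A"
proof (induction n)
  case 0
  have "A \<in> sets \<rho>" using \<rho> A by (simp add: stationary_law_def)
  then show ?case by (simp add: visit_prob_0)
next
  case (Suc n)
  have "(\<integral>x. visit_prob A n x \<partial>\<rho>) = (\<integral>x. \<integral>t. visit_prob A n (battery_step E x t) \<partial>\<mu> \<partial>\<rho>)"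
    using \<rho> measurable_visit_prob[OF A, of n] visit_prob_bounds[of A n]
    unfolding stationary_law_def by (metis abs_of_nonneg)
  with Suc show ?case by (simp add: visit_prob_Suc[OF A])
qed

text \<open>The probability of a visit at or after time m is at least that of a visit at time m,
  whose mean under \<open>\<rho>\<close> is the mass of A. As m tends to infinity this bounds the
  mean probability of infinitely many visits, and that probability does not depend on the starting
  point.\<close>

lemma prob_io_ge_stationary:
  assumes \<rho>: "stationary_law \<rho>" and A: "A \<in> sets borel" and x: "0 \<le> x"
  shows "measure \<rho> A \<le> measure harvests (io_event A x)"
proof -
  have "prob_space \<rho>" and sets_\<rho>[measurable_cong]: "sets \<rho> = sets borel" and nonneg: "AE x in \<rho>. 0 \<le> x"
    using \<rho> by (simp_all add: stationary_law_def)
  interpret \<rho>: prob_space \<rho> by fact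
  define T where "T m x = {\<omega>. \<exists>n\<ge>m. battery_path E x n \<omega> \<in> A}" for m x
  have sets_T: "T m x \<in> sets harvests" for m x
  proof -
    have "T m x = (\<Union>n\<in>{m..}. {\<omega>. battery_path E x n \<omega> \<in> A})" by (auto simp: T_def)
    also have "\<dots> \<in> sets harvests" using sets_visit[OF A] by (intro sets.countable_UN') auto
    finally show ?thesis .
  qed
  have meas_T: "(\<lambda>x. measure harvests (T m x)) \<in> borel_measurable borel" for m
  proof -
    note [measurable] = pred_path_pair[OF A]
    show ?thesis unfolding T_def by (rule measurable_prob_section) measurable
  qed
  have "(\<lambda>m. measure harvests (T m y)) \<longlonglongrightarrow> measure harvests (\<Inter>m. T m y)" for y
    using sets_T by (intro harvests.finite_Lim_measure_decseq) (auto simp: decseq_def T_def intro: order_trans)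
  moreover have "(\<Inter>m. T m y) = io_event A y" for y by (auto simp: T_def io_event_def INFM_nat_le)
  ultimately have lim: "(\<lambda>m. measure harvests (T m y)) \<longlonglongrightarrow> measure harvests (io_event A y)" for y by simp
  have "(\<lambda>m. \<integral>y. measure harvests (T m y) \<partial>\<rho>) \<longlonglongrightarrow> (\<integral>y. measure harvests (io_event A y) \<partial>\<rho>)"
    using meas_T measurable_prob_section[OF pred_io_pair[OF A]] lim
    by (intro integral_dominated_convergence[where w = "\<lambda>_. 1"]) (auto simp: measurable_cong_sets[OF sets_\<rho> refl])
  moreover have "measure \<rho> A \<le> (\<integral>y. measure harvests (T m y) \<partial>\<rho>)" for m
  proof -
    have "measure \<rho> A = (\<integral>y. visit_prob A m y \<partial>\<rho>)" by (rule stationary_visit_prob[OF \<rho> A, symmetric])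
    also have "\<dots> \<le> (\<integral>y. measure harvests (T m y) \<partial>\<rho>)"
    proof (rule integral_mono)
      show "integrable \<rho> (visit_prob A m)"
        using measurable_visit_prob[OF A] visit_prob_bounds
        by (intro \<rho>.integrable_const_bound[where B = 1]) (auto simp: measurable_cong_sets[OF sets_\<rho> refl])
      show "integrable \<rho> (\<lambda>y. measure harvests (T m y))"
        using meas_T by (intro \<rho>.integrable_const_bound[where B = 1]) (auto simp: measurable_cong_sets[OF sets_\<rho> refl])
      show "visit_prob A m y \<le> measure harvests (T m y)" for y
        unfolding visit_prob_def by (rule harvests.finite_measure_mono[OF _ sets_T]) (auto simp: T_def)
    qed
    finally show ?thesis .
  qed
  ultimately have "measure \<rho> A \<le> (\<integral>y. measure harvests (io_event A y) \<partial>\<rho>)"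
    by (intro LIMSEQ_le_const) auto
  also have "\<dots> = (\<integral>y. measure harvests (io_event A x) \<partial>\<rho>)"
    using nonneg measurable_prob_section[OF pred_io_pair[OF A]]
    by (intro integral_cong_AE) (auto simp: measurable_cong_sets[OF sets_\<rho> refl] prob_io_constant[OF A _ x])
  also have "\<dots> = measure harvests (io_event A x)" by (simp add: \<rho>.prob_space)
  finally show ?thesis .
qed

lemma prob_io_eq_1:
  assumes "invariant_probability battery_space chain_kernel \<pi>"
    and A: "A \<in> sets battery_space" "0 < emeasure \<pi> A" and x: "0 \<le> x"
  shows "emeasure harvests (io_event A x) = 1"
proof -
  define \<rho> where "\<rho> = distr \<pi> borel (\<lambda>x. x)"
  have \<rho>: "stationary_law \<rho>" "emeasure \<rho> A = emeasure \<pi> A"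
    unfolding \<rho>_def using invariant_imp_stationary[OF assms(1)] A by auto
  then interpret \<rho>: prob_space \<rho> by (simp add: stationary_law_def)
  have A': "A \<in> sets borel" using A(1) by (simp add: sets_battery_space)
  have "0 < measure \<rho> A" using A(2) unfolding \<rho>(2)[symmetric] \<rho>.emeasure_eq_measure by simp
  also have "\<dots> \<le> measure harvests (io_event A x)" by (rule prob_io_ge_stationary[OF \<rho>(1) A' x])
  finally show ?thesis using prob_io_zero_one[OF A' x] by (simp add: harvests.emeasure_eq_measure)
qed

section \<open>Uniqueness of the invariant probability\<close>

lemma stationary_periodic_integral_eq:
  fixes \<phi> :: "real \<Rightarrow> real"
  assumes \<rho>: "stationary_law \<rho>" and \<sigma>: "stationary_law \<sigma>"
    and \<phi>[measurable]: "\<phi> \<in> borel_measurable borel" and bound: "\<And>x. \<bar>\<phi> x\<bar> \<le> C" and per: "\<And>x. \<phi> (x + E) = \<phi> x"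
  shows "(\<integral>x. \<phi> x \<partial>\<rho>) = (\<integral>x. \<phi> x \<partial>\<sigma>)"
proof -
  \<comment> \<open>Modulo \<open>E\<close> a step of the chain is translation by the harvest.
    Stationarity therefore makes the translated mean of \<open>\<phi>\<close>, as a function of u,
    harmonic on the circle, hence constant.\<close>
  have const: "(\<integral>x. \<phi> (u + x) \<partial>\<rho>) = (\<integral>x. \<phi> x \<partial>\<rho>)" if \<rho>: "stationary_law \<rho>" for \<rho> u
  proof -
    have "prob_space \<rho>" and sets_\<rho>[measurable_cong]: "sets \<rho> = sets borel"
      using \<rho> by (simp_all add: stationary_law_def)
    interpret \<rho>: prob_space \<rho> by fact
    interpret P: pair_prob_space \<mu> \<rho> ..
    have "(\<integral>x. \<phi> (u + x) \<partial>\<rho>) = (\<integral>x. \<phi> (0 + x) \<partial>\<rho>)"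
    proof (rule harmonic_periodic_constant[where k = "\<lambda>u. \<integral>x. \<phi> (u + x) \<partial>\<rho>" and C = C])
      show "(\<lambda>u. \<integral>x. \<phi> (u + x) \<partial>\<rho>) \<in> borel_measurable borel"
        by (rule \<rho>.borel_measurable_lebesgue_integral) measurable
      fix u
      have i: "integrable \<rho> (\<lambda>x. \<phi> (u + x))"
        using bound by (intro \<rho>.integrable_const_bound[where B = C]) auto
      have "\<bar>\<integral>x. \<phi> (u + x) \<partial>\<rho>\<bar> \<le> (\<integral>x. C \<partial>\<rho>)"
        by (rule integral_abs_bound_integral[OF i]) (auto simp: bound)
      then show "\<bar>\<integral>x. \<phi> (u + x) \<partial>\<rho>\<bar> \<le> C" by (simp add: \<rho>.prob_space)
      show "(\<integral>x. \<phi> (u + E + x) \<partial>\<rho>) = (\<integral>x. \<phi> (u + x) \<partial>\<rho>)"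
        using per[of "u + _"] by (simp add: add_ac)
      have step: "\<phi> (u + battery_step E x t) = \<phi> (u + \<bar>t\<bar> + x)" for x t
        using per[of "u + battery_step E x t"]
        by (auto simp: battery_step_def indicator_def algebra_simps)
      have "(\<integral>x. \<phi> (u + x) \<partial>\<rho>) = (\<integral>x. \<integral>t. \<phi> (u + battery_step E x t) \<partial>\<mu> \<partial>\<rho>)"
        using \<rho> bound unfolding stationary_law_def
        by (elim conjE allE[of _ "\<lambda>x. \<phi> (u + x)"]) auto
      also have "\<dots> = (\<integral>x. \<integral>t. \<phi> (u + \<bar>t\<bar> + x) \<partial>\<mu> \<partial>\<rho>)" by (simp only: step)
      also have "\<dots> = (\<integral>t. \<integral>x. \<phi> (u + \<bar>t\<bar> + x) \<partial>\<rho> \<partial>\<mu>)"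
        by (rule P.Fubini_integral, rule P.integrable_const_bound[where B = C]) (auto simp: bound)
      finally show "(\<integral>x. \<phi> (u + x) \<partial>\<rho>) = (\<integral>t. \<integral>x. \<phi> (u + \<bar>t\<bar> + x) \<partial>\<rho> \<partial>\<mu>)" .
    qed
    then show ?thesis by simp
  qed
  have "prob_space \<rho>" "prob_space \<sigma>" and sets_\<rho>[measurable_cong]: "sets \<rho> = sets borel" "sets \<sigma> = sets borel"
    using \<rho> \<sigma> by (simp_all add: stationary_law_def)
  interpret \<rho>: prob_space \<rho> by fact
  interpret \<sigma>: prob_space \<sigma> by fact
  interpret P: pair_prob_space \<rho> \<sigma> ..
  \<comment> \<open>The mean of \<open>\<phi>\<close> under the convolution of the two laws equals,
    by \<open>const\<close>, its mean under each of them.\<close>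
  have "(\<integral>y. \<integral>x. \<phi> (y + x) \<partial>\<rho> \<partial>\<sigma>) = (\<integral>x. \<integral>y. \<phi> (y + x) \<partial>\<sigma> \<partial>\<rho>)"
    by (rule P.Fubini_integral, rule P.integrable_const_bound[where B = C]) (auto simp: bound)
  also have "\<dots> = (\<integral>x. \<integral>y. \<phi> (x + y) \<partial>\<sigma> \<partial>\<rho>)" by (simp only: add.commute)
  finally show ?thesis
    unfolding const[OF \<rho>] const[OF \<sigma>] by (simp add: \<rho>.prob_space \<sigma>.prob_space)
qed

text \<open>Starting from the representative modulo \<open>E\<close> makes the visit probability
  periodic, so both laws give it the same mean. By merging, the replacement costs nothing as n
  grows, while the true visit probabilities have the mass of A as their mean at every n.\<close>

lemma stationary_law_unique:
  assumes \<rho>: "stationary_law \<rho>" and \<sigma>: "stationary_law \<sigma>" and A: "A \<in> sets borel"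
  shows "measure \<rho> A = measure \<sigma> A"
proof -
  define \<psi> where "\<psi> n x = visit_prob A n (reduce x)" for n x
  note [measurable] = measurable_visit_prob[OF A]
  have \<psi>[measurable]: "\<psi> n \<in> borel_measurable borel" for n unfolding \<psi>_def by measurable
  have \<psi>_bound: "\<bar>\<psi> n x\<bar> \<le> 1" for n x unfolding \<psi>_def using visit_prob_bounds[of A n "reduce x"] by simp
  have lim: "(\<lambda>n. \<integral>x. \<psi> n x \<partial>\<rho>) \<longlonglongrightarrow> measure \<rho> A" if \<rho>: "stationary_law \<rho>" for \<rho>
  proof -
    have "prob_space \<rho>" and sets_\<rho>[measurable_cong]: "sets \<rho> = sets borel" and nonneg: "AE x in \<rho>. 0 \<le> x"
      using \<rho> by (simp_all add: stationary_law_def)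
    interpret \<rho>: prob_space \<rho> by fact
    have "(\<lambda>n. \<integral>x. \<psi> n x - visit_prob A n x \<partial>\<rho>) \<longlonglongrightarrow> (\<integral>x. 0 \<partial>\<rho>)"
    proof (rule integral_dominated_convergence[where w = "\<lambda>_. 1"])
      show "AE x in \<rho>. (\<lambda>n. \<psi> n x - visit_prob A n x) \<longlonglongrightarrow> 0"
        using nonneg
      proof eventually_elim
        fix x :: real assume "0 \<le> x"
        from reduce_decompose[OF this] obtain m where m: "x = reduce x + real m * E" by blast
        have "(\<lambda>n. visit_prob A n (reduce x) - visit_prob A n (reduce x + real m * E)) \<longlonglongrightarrow> 0"
          using visit_prob_bounds[of A]
          by (intro fibre_differences_tendsto_0[where C = 1] visit_prob_Suc[OF A] reduce_bounds) auto
        then show "(\<lambda>n. \<psi> n x - visit_prob A n x) \<longlonglongrightarrow> 0"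
          unfolding \<psi>_def using m by simp
      qed
      show "AE x in \<rho>. norm (\<psi> n x - visit_prob A n x) \<le> 1" for n
        using visit_prob_bounds[of A n] unfolding \<psi>_def
        by (intro AE_I2) (smt (verit) real_norm_def)
    qed auto
    moreover have "(\<integral>x. \<psi> n x - visit_prob A n x \<partial>\<rho>) = (\<integral>x. \<psi> n x \<partial>\<rho>) - measure \<rho> A" for n
      using \<psi>_bound visit_prob_bounds[of A n]
      by (subst Bochner_Integration.integral_diff)
        (auto intro!: \<rho>.integrable_const_bound[where B = 1] simp: stationary_visit_prob[OF \<rho> A])
    ultimately show ?thesis by (simp add: LIM_zero_iff)
  qed
  have "(\<integral>x. \<psi> n x \<partial>\<rho>) = (\<integral>x. \<psi> n x \<partial>\<sigma>)" for n
    by (rule stationary_periodic_integral_eq[OF \<rho> \<sigma> \<psi> \<psi>_bound]) (simp add: \<psi>_def reduce_periodic)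
  then show ?thesis using LIMSEQ_unique[OF lim[OF \<rho>]] lim[OF \<sigma>] by simp
qed

lemma invariant_probability_unique:
  assumes "invariant_probability battery_space chain_kernel \<pi>" "invariant_probability battery_space chain_kernel \<pi>'"
  shows "\<pi> = \<pi>'"
proof (rule measure_eqI)
  show sets: "sets \<pi> = sets \<pi>'" using assms by (simp add: invariant_probability_def)
  fix A assume "A \<in> sets \<pi>"
  then have A: "A \<in> sets battery_space" using assms by (simp add: invariant_probability_def)
  then have A': "A \<in> sets borel" by (simp add: sets_battery_space)
  note 1 = invariant_imp_stationary[OF assms(1)] and 2 = invariant_imp_stationary[OF assms(2)]
  interpret \<rho>: prob_space "distr \<pi> borel (\<lambda>x. x)" using 1(1) by (simp add: stationary_law_def)
  interpret \<sigma>: prob_space "distr \<pi>' borel (\<lambda>x. x)" using 2(1) by (simp add: stationary_law_def)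
  have "emeasure (distr \<pi> borel (\<lambda>x. x)) A = emeasure (distr \<pi>' borel (\<lambda>x. x)) A"
    using stationary_law_unique[OF 1(1) 2(1) A'] by (simp add: \<rho>.emeasure_eq_measure \<sigma>.emeasure_eq_measure)
  then show "emeasure \<pi> A = emeasure \<pi>' A" using 1(2)[OF A] 2(2)[OF A] by simp
qed

section \<open>Irreducibility and Harris recurrence\<close>

lemma return_prob_ge_io:
  assumes "0 \<le> x" "A \<in> sets battery_space"
  shows "emeasure harvests (io_event A x) \<le> return_prob battery_space chain_kernel x A"
  unfolding return_prob_eq[OF assms]
proof (rule emeasure_mono)
  show "io_event A x \<subseteq> {\<omega>. \<exists>n\<ge>1. battery_path E x n \<omega> \<in> A}"
    by (auto simp: io_event_def INFM_nat_le)
  have "{\<omega>. \<exists>n\<ge>1. battery_path E x n \<omega> \<in> A} = (\<Union>n\<in>{1..}. {\<omega>. battery_path E x n \<omega> \<in> A})" by auto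
  also have "\<dots> \<in> sets harvests"
    using sets_visit assms(2) by (intro sets.countable_UN') (auto simp: sets_battery_space)
  finally show "{\<omega>. \<exists>n\<ge>1. battery_path E x n \<omega> \<in> A} \<in> sets harvests" .
qed

text \<open>A null set is missed at each fixed time from almost every starting point, hence at all
  times from some point. This gives maximality: no irreducibility measure can charge such a
  set.\<close>

lemma invariant_null_imp_return_prob_0:
  assumes inv: "invariant_probability battery_space chain_kernel \<pi>"
    and A: "A \<in> sets battery_space" and null: "emeasure \<pi> A = 0"
  shows "\<exists>x\<ge>0. return_prob battery_space chain_kernel x A = 0"
proof -
  define \<rho> where "\<rho> = distr \<pi> borel (\<lambda>x. x)"
  have \<rho>: "stationary_law \<rho>" "emeasure \<rho> A = 0"
    unfolding \<rho>_def using invariant_imp_stationary[OF inv] A null by auto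
  then interpret \<rho>: prob_space \<rho> by (simp add: stationary_law_def)
  have sets_\<rho>: "sets \<rho> = sets borel" and nonneg: "AE x in \<rho>. 0 \<le> x"
    using \<rho>(1) by (simp_all add: stationary_law_def)
  have A': "A \<in> sets borel" using A by (simp add: sets_battery_space)
  have "AE x in \<rho>. visit_prob A n x = 0" for n
  proof -
    have "integrable \<rho> (visit_prob A n)"
      using measurable_visit_prob[OF A'] visit_prob_bounds
      by (intro \<rho>.integrable_const_bound[where B = 1]) (auto simp: measurable_cong_sets[OF sets_\<rho> refl])
    moreover have "(\<integral>x. visit_prob A n x \<partial>\<rho>) = 0"
      using stationary_visit_prob[OF \<rho>(1) A'] \<rho>(2) by (simp add: measure_def)
    ultimately show ?thesis using visit_prob_bounds by (subst (asm) integral_nonneg_eq_0_iff_AE) auto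
  qed
  then have "AE x in \<rho>. \<forall>n. visit_prob A n x = 0" by (simp add: AE_all_countable)
  with nonneg have ae: "AE x in \<rho>. 0 \<le> x \<and> (\<forall>n. visit_prob A n x = 0)" by eventually_elim auto
  have "\<exists>x\<ge>0. \<forall>n. visit_prob A n x = 0"
  proof (rule ccontr)
    assume none: "\<not> ?thesis"
    from ae have "AE x in \<rho>. False" by eventually_elim (use none in blast)
    then show False by (simp only: \<rho>.AE_False)
  qed
  then obtain x where x: "0 \<le> x" "\<And>n. visit_prob A n x = 0" by blast
  have "{\<omega>. \<exists>n\<ge>1. battery_path E x n \<omega> \<in> A} = (\<Union>n\<in>{1..}. {\<omega>. battery_path E x n \<omega> \<in> A})" by auto
  also have "emeasure harvests \<dots> = 0"
    using x(2) by (intro null_setsD1[OF null_sets_UN'])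
      (auto simp: visit_prob_def harvests.emeasure_eq_measure null_sets_def sets_visit[OF A'])
  finally show ?thesis using x(1) return_prob_eq[OF x(1) A] by auto
qed

text \<open>Take \<open>\<pi>\<close> as the maximal irreducibility measure. Sets it charges are
  visited infinitely often with probability 1 from every state, which yields both irreducibility and
  the Harris property.\<close>

lemma positive_harris_recurrent_battery: "positive_harris_recurrent battery_space chain_kernel"
proof -
  obtain \<pi> where inv: "invariant_probability battery_space chain_kernel \<pi>"
    using invariant_probability_exists by blast
  then have "prob_space \<pi>" and sets_\<pi>: "sets \<pi> = sets battery_space"
    by (simp_all add: invariant_probability_def)
  interpret \<pi>: prob_space \<pi> by fact
  have space_\<pi>: "space \<pi> = {0..}" using sets_eq_imp_space_eq[OF sets_\<pi>] by simp
  have irr: "irreducibility_measure battery_space chain_kernel \<pi>"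
    unfolding irreducibility_measure_def
  proof (intro conjI ballI impI)
    show "sigma_finite_measure \<pi>" ..
    show "0 < emeasure \<pi> (space battery_space)" using \<pi>.emeasure_space_1 by (simp add: space_\<pi>)
    fix A x assume A: "A \<in> sets battery_space" "0 < emeasure \<pi> A" and x: "x \<in> space battery_space"
    then have "0 \<le> x" by simp
    from return_prob_ge_io[OF this A(1)] prob_io_eq_1[OF inv A this]
    show "0 < return_prob battery_space chain_kernel x A"
      by (metis zero_less_one order_less_le_trans)
  qed (rule sets_\<pi>)
  have "absolutely_continuous \<pi> \<phi>" if \<phi>: "irreducibility_measure battery_space chain_kernel \<phi>" for \<phi>
    unfolding absolutely_continuous_def
  proof
    fix A assume "A \<in> null_sets \<pi>"
    then have A: "A \<in> sets battery_space" "emeasure \<pi> A = 0" by (auto simp: sets_\<pi>)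
    obtain x where x: "0 \<le> x" "return_prob battery_space chain_kernel x A = 0"
      using invariant_null_imp_return_prob_0[OF inv A] by blast
    have "emeasure \<phi> A = 0"
    proof (rule ccontr)
      assume "emeasure \<phi> A \<noteq> 0"
      then have "0 < emeasure \<phi> A" by (simp add: zero_less_iff_neq_zero)
      with \<phi> A(1) x(1) have "0 < return_prob battery_space chain_kernel x A"
        unfolding irreducibility_measure_def by auto
      with x(2) show False by simp
    qed
    then show "A \<in> null_sets \<phi>"
      using \<phi> A(1) by (auto simp: irreducibility_measure_def null_sets_def not_less)
  qed
  with irr have "maximal_irreducibility_measure battery_space chain_kernel \<pi>"
    by (simp add: maximal_irreducibility_measure_def)
  moreover have "harris_recurrent_set battery_space chain_kernel A"
    if "A \<in> sets battery_space" "0 < emeasure \<pi> A" for A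
    unfolding harris_recurrent_set_def
  proof
    fix x assume "x \<in> A"
    then have "0 \<le> x" using that(1) by (auto simp: sets_battery_space)
    with prob_io_eq_1[OF inv that this]
    show "infinitely_often_prob battery_space chain_kernel x A = 1"
      by (simp add: infinitely_often_prob_eq[OF _ that(1)] io_event_def)
  qed
  ultimately show ?thesis
    unfolding positive_harris_recurrent_def harris_recurrent_def
    using transition_kernel_battery inv by blast
qed

end

section \<open>From the given random variables to the harvest law\<close>

lemma battery_kernel_distr:
  assumes Y[measurable]: "Y \<in> borel_measurable M" and nonneg: "\<And>\<omega>. \<omega> \<in> space M \<Longrightarrow> 0 \<le> Y \<omega>"
  shows "battery_kernel M Y E = battery_kernel (distr M borel Y) abs E"
proof
  fix b
  let ?f = "\<lambda>t. b + t - indicator {E<..} b * E"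
  show "battery_kernel M Y E b = battery_kernel (distr M borel Y) abs E b"
    unfolding battery_kernel_def distr_def[of _ battery_space]
  proof (rule measure_of_eq[OF sets.space_closed])
    fix A assume "A \<in> sigma_sets (space battery_space) (sets battery_space)"
    then have "A \<in> sets battery_space" by (simp only: sets.sigma_sets_eq)
    then have [measurable]: "A \<in> sets borel" by (simp add: sets_battery_space)
    have "(\<lambda>t. ?f \<bar>t\<bar>) \<in> borel_measurable borel" by measurable
    from measurable_sets[OF this, of A] have "(\<lambda>t. ?f \<bar>t\<bar>) -` A \<in> sets borel" by simp
    then have "emeasure (distr M borel Y) ((\<lambda>t. ?f \<bar>t\<bar>) -` A \<inter> space (distr M borel Y)) =
        emeasure M (Y -` ((\<lambda>t. ?f \<bar>t\<bar>) -` A) \<inter> space M)"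
      by (simp add: emeasure_distr)
    also have "Y -` ((\<lambda>t. ?f \<bar>t\<bar>) -` A) \<inter> space M = (\<lambda>\<omega>. ?f (Y \<omega>)) -` A \<inter> space M"
      using nonneg by auto
    finally show "emeasure M ((\<lambda>\<omega>. ?f (Y \<omega>)) -` A \<inter> space M) =
        emeasure (distr M borel Y) ((\<lambda>t. ?f \<bar>t\<bar>) -` A \<inter> space (distr M borel Y))" ..
  qed
qed

lemma battery_path_to_stream:
  assumes "\<And>k. H k \<ge> 0" and "\<And>k. B (Suc k) = B k + H k - indicator {E<..} (B k) * E"
  shows "battery_path E (B 0) n (to_stream H) = B n"
  using assms
proof (induction n arbitrary: H B)
  case (Suc n)
  have "to_stream H = H 0 ## to_stream (\<lambda>k. H (Suc k))"
  proof -
    have "case_nat (H 0) (\<lambda>k. H (Suc k)) = H" by (rule ext) (simp split: nat.split)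
    with to_stream_nat_case[of "H 0" "\<lambda>k. H (Suc k)"] show ?thesis by simp
  qed
  moreover have "battery_step E (B 0) (H 0) = B (Suc 0)"
    using Suc.prems(1)[of 0] Suc.prems(2)[of 0] by (simp add: battery_step_def)
  ultimately show ?case
    using Suc.IH[of "\<lambda>k. H (Suc k)" "\<lambda>k. B (Suc k)"] Suc.prems by simp
qed simp

theorem mainTheorem3:
  fixes M :: "'w measure" and H B :: "nat \<Rightarrow> 'w \<Rightarrow> real" and E_s :: real
  assumes "prob_space M"
    and "E_s > 0"
    and H_indep: "prob_space.indep_vars M (\<lambda>_. borel) H UNIV"
    and H_ident: "\<And>k. distr M borel (H k) = distr M borel (H 0)"
    and H_nonneg: "\<And>k \<omega>. \<omega> \<in> space M \<Longrightarrow> H k \<omega> \<ge> 0"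
    and H_ac: "absolutely_continuous lborel (distr M borel (H 0))"
    and H_mean_finite: "integrable M (H 0)"
    and B0_nonneg: "\<And>\<omega>. \<omega> \<in> space M \<Longrightarrow> B 0 \<omega> \<ge> 0"
    and B0_measurable: "B 0 \<in> borel_measurable M"
    and B0_indep: "prob_space.indep_set M
      (sets (vimage_algebra (space M) (B 0) borel))
      (sets (vimage_algebra (space M) (\<lambda>\<omega> k. H k \<omega>) (PiM UNIV (\<lambda>_. borel))))"
    and B_Suc: "\<And>k \<omega>. \<omega> \<in> space M \<Longrightarrow>
      B (Suc k) \<omega> = B k \<omega> + H k \<omega> - indicator {E_s<..} (B k \<omega>) * E_s"
    and H_mean_less: "prob_space.expectation M (H 0) < E_s"
  shows "markov_chain M battery_space (battery_kernel M (H 0) E_s) B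
    \<and> positive_harris_recurrent battery_space (battery_kernel M (H 0) E_s)
    \<and> (\<exists>!\<pi>. invariant_probability battery_space (battery_kernel M (H 0) E_s) \<pi>)"
proof -
  interpret M: prob_space M by fact
  have H[measurable]: "H k \<in> borel_measurable M" for k
    using H_indep by (simp add: M.indep_vars_def)
  note [measurable] = B0_measurable
  define \<mu> where "\<mu> = distr M borel (H 0)"
  have abs_H: "\<bar>H 0 \<omega>\<bar> = H 0 \<omega>" if "\<omega> \<in> space M" for \<omega> using H_nonneg[OF that] by simp
  have "prob_space \<mu>" unfolding \<mu>_def by (rule M.prob_space_distr) simp
  then interpret battery \<mu> E_s
  proof (rule battery.intro, intro battery_axioms.intro)
    show "integrable \<mu> (\<lambda>t. \<bar>t\<bar>)"
      unfolding \<mu>_def using H_mean_finite by (subst integrable_distr_eq) auto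
    have "(\<integral>t. \<bar>t\<bar> \<partial>\<mu>) = (\<integral>\<omega>. H 0 \<omega> \<partial>M)"
      unfolding \<mu>_def by (subst integral_distr) (auto intro!: Bochner_Integration.integral_cong simp: abs_H)
    then show "(\<integral>t. \<bar>t\<bar> \<partial>\<mu>) < E_s" using H_mean_less by simp
  qed (use \<open>E_s > 0\<close> H_ac in \<open>simp_all add: \<mu>_def\<close>)
  have kernel: "battery_kernel M (H 0) E_s = chain_kernel"
    unfolding \<mu>_def by (rule battery_kernel_distr) (auto simp: H_nonneg)
  \<comment> \<open>The chain is a deterministic function of the initial state and the harvest
    sequence, so only their joint law matters.\<close>
  have path: "B n \<omega> = battery_path E_s (B 0 \<omega>) n (to_stream (\<lambda>k. H k \<omega>))" if "\<omega> \<in> space M" for n \<omega>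
    by (rule battery_path_to_stream[symmetric]) (use that H_nonneg B_Suc in auto)
  have B_nonneg: "0 \<le> B n \<omega>" if "\<omega> \<in> space M" for n \<omega>
    by (subst path[OF that]) (rule battery_path_nonneg[OF E_pos B0_nonneg[OF that]])
  have H_seq_meas[measurable]: "(\<lambda>\<omega> k. H k \<omega>) \<in> M \<rightarrow>\<^sub>M PiM UNIV (\<lambda>_. borel)"
    by (rule measurable_PiM_single') auto
  have B_meas: "B n \<in> M \<rightarrow>\<^sub>M battery_space" for n
  proof (rule measurable_battery_spaceI[OF _ B_nonneg])
    have "(\<lambda>\<omega>. battery_path E_s (B 0 \<omega>) n (to_stream (\<lambda>k. H k \<omega>))) \<in> borel_measurable M"
      by measurable
    then show "B n \<in> borel_measurable M" by (subst measurable_cong[OF path])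
  qed
  let ?P = "PiM UNIV (\<lambda>_::nat. borel) :: (nat \<Rightarrow> real) measure"
  have H_seq: "distr M ?P (\<lambda>\<omega> k. H k \<omega>) = PiM UNIV (\<lambda>_. \<mu>)"
  proof -
    have "(\<lambda>i. distr M borel (H i)) = (\<lambda>_. \<mu>)" unfolding \<mu>_def by (rule ext) (rule H_ident)
    then show ?thesis
      using H_indep M.indep_vars_iff_distr_eq_PiM[where I = UNIV and M' = "\<lambda>_. borel" and X = H]
      by (simp add: restrict_UNIV)
  qed
  interpret Pi: product_prob_space "\<lambda>_. \<mu>" "UNIV :: nat set" ..
  \<comment> \<open>Independence of the initial state from the whole harvest sequence, checked on
    rectangles, makes the joint law a product.\<close>
  have joint: "distr M borel (B 0) \<Otimes>\<^sub>M PiM UNIV (\<lambda>_. \<mu>) = distr M (borel \<Otimes>\<^sub>M ?P) (\<lambda>\<omega>. (B 0 \<omega>, \<lambda>k. H k \<omega>))"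
  proof (rule pair_measure_eqI)
    show "sigma_finite_measure (distr M borel (B 0))"
      by (intro prob_space_imp_sigma_finite M.prob_space_distr) simp
    show "sigma_finite_measure (PiM UNIV (\<lambda>_::nat. \<mu>))" ..
    show "sets (distr M borel (B 0) \<Otimes>\<^sub>M PiM UNIV (\<lambda>_. \<mu>)) =
        sets (distr M (borel \<Otimes>\<^sub>M ?P) (\<lambda>\<omega>. (B 0 \<omega>, \<lambda>k. H k \<omega>)))"
      unfolding H_seq[symmetric] sets_distr by (intro sets_pair_measure_cong) simp_all
    fix C D
    assume "C \<in> sets (distr M borel (B 0))" and "D \<in> sets (PiM UNIV (\<lambda>_::nat. \<mu>))"
    then have C: "C \<in> sets borel" and D: "D \<in> sets ?P" by (simp_all add: H_seq[symmetric])
    have "M.prob ((B 0 -` C \<inter> space M) \<inter> ((\<lambda>\<omega> k. H k \<omega>) -` D \<inter> space M)) =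
        M.prob (B 0 -` C \<inter> space M) * M.prob ((\<lambda>\<omega> k. H k \<omega>) -` D \<inter> space M)"
      by (rule M.indep_setD[OF B0_indep]) (auto intro: in_vimage_algebra C D)
    moreover have "(\<lambda>\<omega>. (B 0 \<omega>, \<lambda>k. H k \<omega>)) -` (C \<times> D) \<inter> space M =
        (B 0 -` C \<inter> space M) \<inter> ((\<lambda>\<omega> k. H k \<omega>) -` D \<inter> space M)" by auto
    ultimately show "emeasure (distr M borel (B 0)) C * emeasure (PiM UNIV (\<lambda>_. \<mu>)) D =
        emeasure (distr M (borel \<Otimes>\<^sub>M ?P) (\<lambda>\<omega>. (B 0 \<omega>, \<lambda>k. H k \<omega>))) (C \<times> D)"
      unfolding H_seq[symmetric] using C D
      by (simp add: emeasure_distr M.emeasure_eq_measure ennreal_mult)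
  qed
  \<comment> \<open>The product law allows integrating over the harvests with the initial state
    fixed at x, where \<open>emeasure_path_cylinder\<close> evaluates the result, and then over
    x.\<close>
  have fdd_eq: "emeasure M {\<omega> \<in> space M. \<forall>i\<le>n. B i \<omega> \<in> A i} = (\<integral>\<^sup>+x. fdd chain_kernel n A x \<partial>distr M battery_space (B 0))"
    if A: "\<And>i. i \<le> n \<Longrightarrow> A i \<in> sets battery_space" for n A
  proof -
    define F where "F x s = (\<Prod>i\<le>n. indicator (A i) (battery_path E_s x i s) :: ennreal)" for x s
    have F_eq: "F x s = indicator {s. \<forall>i\<le>n. battery_path E_s x i s \<in> A i} s" for x s
      by (auto simp: F_def indicator_def prod_zero_iff)
    have F[measurable]: "(\<lambda>p. F (fst p) (snd p)) \<in> borel_measurable (borel \<Otimes>\<^sub>M stream_space borel)"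
      unfolding F_def
    proof (rule borel_measurable_prod_ennreal)
      fix i assume "i \<in> {..n}"
      then have "indicator (A i) \<in> borel_measurable (borel :: real measure)"
        using A[of i] by (intro borel_measurable_indicator) (simp add: sets_battery_space)
      then show "(\<lambda>p. indicator (A i) (battery_path E_s (fst p) i (snd p)) :: ennreal)
          \<in> borel_measurable (borel \<Otimes>\<^sub>M stream_space borel)"
        by (rule measurable_compose[rotated]) measurable
    qed
    have F': "(\<lambda>q. F (fst q) (to_stream (snd q))) \<in> borel_measurable (borel \<Otimes>\<^sub>M ?P)"
    proof -
      have "(\<lambda>q. (fst q, to_stream (snd q))) \<in> borel \<Otimes>\<^sub>M ?P \<rightarrow>\<^sub>M borel \<Otimes>\<^sub>M stream_space borel"
        by measurable
      from measurable_compose[OF this F] show ?thesis by simp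
    qed
    then have F'': "(\<lambda>q. F (fst q) (to_stream (snd q))) \<in> borel_measurable (distr M borel (B 0) \<Otimes>\<^sub>M PiM UNIV (\<lambda>_. \<mu>))"
      by (simp only: joint measurable_distr_eq1)
    have F_fdd: "(\<integral>\<^sup>+h. F x (to_stream h) \<partial>PiM UNIV (\<lambda>_. \<mu>)) = fdd chain_kernel n A x" if x: "0 \<le> x" for x
    proof -
      have Fx: "F x \<in> borel_measurable harvests"
        using measurable_compose[OF _ F, of "\<lambda>s. (x, s)" harvests] by simp
      have "(\<integral>\<^sup>+h. F x (to_stream h) \<partial>PiM UNIV (\<lambda>_. \<mu>)) = (\<integral>\<^sup>+s. F x s \<partial>harvests)"
        using arg_cong[where f = "\<lambda>N. \<integral>\<^sup>+s. F x s \<partial>N", OF stream_space_eq_distr[of \<mu>]]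
          nn_integral_distr[OF measurable_to_stream, of "F x" \<mu>] Fx by simp
      also have "\<dots> = emeasure harvests {s. \<forall>i\<le>n. battery_path E_s x i s \<in> A i}"
      proof -
        have "{s \<in> space harvests. F x s = 1} \<in> sets harvests" using Fx by measurable
        then have "{s. \<forall>i\<le>n. battery_path E_s x i s \<in> A i} \<in> sets harvests"
          by (simp add: F_eq indicator_def)
        then show ?thesis unfolding F_eq by simp
      qed
      also have "\<dots> = fdd chain_kernel n A x" by (rule emeasure_path_cylinder[OF x A])
      finally show ?thesis .
    qed
    have "emeasure M {\<omega> \<in> space M. \<forall>i\<le>n. B i \<omega> \<in> A i} =
        (\<integral>\<^sup>+\<omega>. indicator {\<omega> \<in> space M. \<forall>i\<le>n. B i \<omega> \<in> A i} \<omega> \<partial>M)"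
    proof (rule nn_integral_indicator[symmetric])
      have "{\<omega> \<in> space M. \<forall>i\<in>{..n}. B i \<omega> \<in> A i} \<in> sets M"
        by (intro sets.sets_Collect_finite_All) (use predE[OF pred_sets2[OF A B_meas]] in auto)
      then show "{\<omega> \<in> space M. \<forall>i\<le>n. B i \<omega> \<in> A i} \<in> sets M" by (simp only: Ball_def atMost_iff)
    qed
    also have "\<dots> = (\<integral>\<^sup>+\<omega>. F (B 0 \<omega>) (to_stream (\<lambda>k. H k \<omega>)) \<partial>M)"
      by (intro nn_integral_cong) (simp add: F_eq indicator_def path[symmetric])
    also have "\<dots> = (\<integral>\<^sup>+q. F (fst q) (to_stream (snd q)) \<partial>distr M (borel \<Otimes>\<^sub>M ?P) (\<lambda>\<omega>. (B 0 \<omega>, \<lambda>k. H k \<omega>)))"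
      using F' by (subst nn_integral_distr) simp_all
    also have "\<dots> = (\<integral>\<^sup>+x. \<integral>\<^sup>+h. F x (to_stream h) \<partial>PiM UNIV (\<lambda>_. \<mu>) \<partial>distr M borel (B 0))"
      unfolding joint[symmetric] using F'' by (subst Pi.P.nn_integral_fst[symmetric]) simp_all
    also have "\<dots> = (\<integral>\<^sup>+\<omega>. \<integral>\<^sup>+h. F (B 0 \<omega>) (to_stream h) \<partial>PiM UNIV (\<lambda>_. \<mu>) \<partial>M)"
      using Pi.P.borel_measurable_nn_integral_fst[OF F''] by (subst nn_integral_distr) simp_all
    also have "\<dots> = (\<integral>\<^sup>+\<omega>. fdd chain_kernel n A (B 0 \<omega>) \<partial>M)"
      by (intro nn_integral_cong F_fdd B0_nonneg)
    also have "\<dots> = (\<integral>\<^sup>+x. fdd chain_kernel n A x \<partial>distr M battery_space (B 0))"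
      using fdd_measurable[OF transition_kernel_battery A] by (subst nn_integral_distr[OF B_meas]) simp_all
    finally show ?thesis .
  qed
  have "markov_chain M battery_space chain_kernel B"
    unfolding markov_chain_def
    using transition_kernel_battery B_meas fdd_eq M.prob_space_axioms by blast
  then show ?thesis
    unfolding kernel
    using positive_harris_recurrent_battery invariant_probability_exists invariant_probability_unique by blast
qed

end
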